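(* Let $\mu>0$ and let $X^{-\mu}=\{X^{-\mu}_t\}_{t\ge0}$ be a Brownian motion with negative drift, $X^{-\mu}_t=-\mu t+\sqrt{2}B_t$ with $B$ a standard Brownian motion (generator $-\mu\frac{d}{dx}+\frac{d^2}{dx^2}$), started at $X^{-\mu}_0=0$. Then $$\max_{0\le s\le t}X^{-\mu}_s\stackrel{d}{=}L_t\wedge T_\mu,\qquad t>0,$$ where $T_\mu$ is an exponential random variable with parameter $\mu$ (i.e. $\mathbf{P}(T_\mu>x)=e^{-\mu x}$) independent of $L$, and $L$ is the inverse of a relativistic stable subordinator with Laplace exponent $\Phi(\lambda)=\sqrt{\lambda+\eta}-\sqrt{\eta}$, $\eta=(\mu/2)^2$.
   Context: For a subordinator $H$ with $H_0=0$ and $\mathbf{E}[e^{-\lambda H_t}]=e^{-t\Phi(\lambda)}$, its inverse is $L_t=\inf\{s>0:H_s>t\}$, $L_0=0$. The relativistic (tempered) stable subordinator of order $1/2$ has Lévy measure $\frac{1}{2\sqrt\pi}e^{-\eta s}s^{-3/2}ds$ and Laplace exponent $\sqrt{\lambda+\eta}-\sqrt\eta$. *)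

theory Defs
  imports "HOL-Probability.Probability"
begin

definition standard_BM :: "'a measure \<Rightarrow> (real \<Rightarrow> 'a \<Rightarrow> real) \<Rightarrow> bool" where
  "standard_BM M B \<longleftrightarrow>
     prob_space M \<and>
     (\<forall>t\<ge>0. B t \<in> borel_measurable M) \<and>
     (\<forall>\<omega>\<in>space M. B 0 \<omega> = 0 \<and> continuous_on {0..} (\<lambda>t. B t \<omega>)) \<and>
     (\<forall>s t. 0 \<le> s \<and> s < t \<longrightarrow>
        distributed M lborel (\<lambda>\<omega>. B t \<omega> - B s \<omega>)
          (\<lambda>x. ennreal (normal_density 0 (sqrt (t - s)) x))) \<and>
     (\<forall>(n::nat) (ts::nat \<Rightarrow> real). 0 \<le> ts 0 \<and> (\<forall>i<n. ts i < ts (Suc i)) \<longrightarrow>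
        prob_space.indep_vars M (\<lambda>_. borel) (\<lambda>i \<omega>. B (ts (Suc i)) \<omega> - B (ts i) \<omega>) {..<n})"

definition subordinator :: "'a measure \<Rightarrow> (real \<Rightarrow> 'a \<Rightarrow> real) \<Rightarrow> bool" where
  "subordinator M H \<longleftrightarrow>
     prob_space M \<and>
     (\<forall>t\<ge>0. H t \<in> borel_measurable M) \<and>
     (\<forall>\<omega>\<in>space M. H 0 \<omega> = 0 \<and> mono_on {0..} (\<lambda>t. H t \<omega>) \<and>
        (\<forall>t\<ge>0. continuous (at_right t) (\<lambda>s. H s \<omega>))) \<and>
     (\<forall>s t. 0 \<le> s \<and> 0 \<le> t \<longrightarrow>
        distr M borel (\<lambda>\<omega>. H (s + t) \<omega> - H s \<omega>) = distr M borel (H t)) \<and>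
     (\<forall>(n::nat) (ts::nat \<Rightarrow> real). 0 \<le> ts 0 \<and> (\<forall>i<n. ts i < ts (Suc i)) \<longrightarrow>
        prob_space.indep_vars M (\<lambda>_. borel) (\<lambda>i \<omega>. H (ts (Suc i)) \<omega> - H (ts i) \<omega>) {..<n})"

definition has_laplace_exponent ::
  "'a measure \<Rightarrow> (real \<Rightarrow> 'a \<Rightarrow> real) \<Rightarrow> (real \<Rightarrow> real) \<Rightarrow> bool" where
  "has_laplace_exponent M H \<Phi> \<longleftrightarrow>
     (\<forall>l\<ge>0. \<forall>t\<ge>0. (\<integral>\<omega>. exp (- l * H t \<omega>) \<partial>M) = exp (- t * \<Phi> l))"

definition inverse_subordinator :: "(real \<Rightarrow> 'a \<Rightarrow> real) \<Rightarrow> real \<Rightarrow> 'a \<Rightarrow> real" where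
  "inverse_subordinator H t \<omega> = (if t = 0 then 0 else Inf {s. 0 < s \<and> t < H s \<omega>})"

text \<open>Independence of two random variables with possibly different value spaces
  (the library's \<open>indep_var\<close> requires a common value type; this is its
  characterisation \<open>indep_var_eq\<close> with heterogeneous types).\<close>
definition indep_rv :: "'a measure \<Rightarrow> 'b measure \<Rightarrow> ('a \<Rightarrow> 'b) \<Rightarrow> 'c measure \<Rightarrow> ('a \<Rightarrow> 'c) \<Rightarrow> bool" where
  "indep_rv M S X T Y \<longleftrightarrow>
     X \<in> measurable M S \<and> Y \<in> measurable M T \<and>
     prob_space.indep_set M
       (sigma_sets (space M) {X -` A \<inter> space M | A. A \<in> sets S})
       (sigma_sets (space M) {Y -` A \<inter> space M | A. A \<in> sets T})"

end

theory Submission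
  imports Defs
begin

text \<open>
  Let \<open>\<tau>\<close> be the first entry time of \<open>X\<close> into \<open>(x, \<infinity>)\<close>, for \<open>x > 0\<close>. With
  \<open>a = sqrt (n + (\<mu> / 2)^2) + \<mu> / 2\<close> the process \<open>exp (a * X s - n * s)\<close> is a martingale, and optional stopping at \<open>\<tau>\<close> gives
  \<open>E [exp (- n * \<tau>); \<tau> < \<infinity>] = exp (- a * x) = exp (- \<mu> * x) * E [exp (- n * H x)]\<close> for all
  \<open>n \<ge> 1\<close>. By the Weierstrass theorem these moments determine laws on \<open>(0, 1]\<close>, so
  \<open>P (\<tau> \<le> t) = exp (- \<mu> * x) * P (H x \<le> t)\<close>. The left side is the probability that the maximum
  exceeds \<open>x\<close>; on the right \<open>H x \<le> t\<close> means \<open>L t > x\<close> up to the event \<open>H x = t\<close>, which is null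
  because \<open>\<tau> = t\<close> forces \<open>X t = x\<close>; and \<open>exp (- \<mu> * x) = P (T > x)\<close>.
\<close>

section \<open>Entry times of continuous paths\<close>

text \<open>The minimum of \<open>T\<close> and the first time at which \<open>f\<close> exceeds \<open>x\<close>.\<close>
definition entry_time :: "(real \<Rightarrow> real) \<Rightarrow> real \<Rightarrow> real \<Rightarrow> real" where
  "entry_time f x T = Inf (insert T {s. 0 \<le> s \<and> x < f s})"

text \<open>The disjunct \<open>K \<le> k\<close> caps the index at \<open>K\<close> and also
  guarantees that the \<open>LEAST\<close> exists. The result is a bounded stopping time of the path
  sampled at multiples of \<open>h\<close>.\<close>

definition grid_index :: "(real \<Rightarrow> real) \<Rightarrow> real \<Rightarrow> real \<Rightarrow> nat \<Rightarrow> nat" where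
  "grid_index f x h K = (LEAST k. K \<le> k \<or> x < f (real k * h))"

text \<open>\<open>exp (- \<tau>)\<close> for the untruncated entry time \<open>\<tau>\<close>, with \<open>exp (- \<infinity>) = 0\<close>.\<close>
definition entry_discount :: "(real \<Rightarrow> real) \<Rightarrow> real \<Rightarrow> real" where
  "entry_discount f x =
     (if \<exists>s\<ge>0. x < f s then exp (- Inf {s. 0 \<le> s \<and> x < f s}) else 0)"

lemma entry_time_bdd: "0 \<le> T \<Longrightarrow> bdd_below (insert T {s. 0 \<le> s \<and> x < f s})"
  by (intro bdd_belowI[of _ 0]) auto

lemma entry_time_nonneg: "0 \<le> T \<Longrightarrow> 0 \<le> entry_time f x T"
  unfolding entry_time_def by (intro cInf_greatest) auto

lemma entry_time_le: "0 \<le> T \<Longrightarrow> entry_time f x T \<le> T"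
  unfolding entry_time_def by (intro cInf_lower entry_time_bdd) auto

lemma entry_time_lower: "0 \<le> T \<Longrightarrow> 0 \<le> s \<Longrightarrow> x < f s \<Longrightarrow> entry_time f x T \<le> s"
  unfolding entry_time_def by (intro cInf_lower entry_time_bdd) auto

lemma entry_time_less_iff:
  assumes "0 \<le> T"
  shows "entry_time f x T < u \<longleftrightarrow> T < u \<or> (\<exists>s\<ge>0. s < u \<and> x < f s)"
  using assms unfolding entry_time_def
  by (subst cInf_less_iff) (auto intro: entry_time_bdd)

lemma continuous_on_gt_right:
  fixes f :: "real \<Rightarrow> real"
  assumes "continuous_on {0..} f" "0 \<le> s" "x < f s"
  obtains d where "d > 0" "\<And>r. 0 \<le> r \<Longrightarrow> \<bar>r - s\<bar> < d \<Longrightarrow> x < f r"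
proof -
  have "\<forall>e>0. \<exists>d>0. \<forall>r\<in>{0..}. dist r s < d \<longrightarrow> dist (f r) (f s) < e"
    using assms(1,2) unfolding continuous_on_iff by (metis atLeast_iff dist_commute)
  then obtain d where "d > 0" "\<forall>r\<in>{0..}. dist r s < d \<longrightarrow> dist (f r) (f s) < f s - x"
    using assms(3) by (metis diff_gt_0_iff_gt)
  then show thesis
    by (intro that[of d]) (fastforce simp: dist_real_def)+
qed

text \<open>Were \<open>f\<close> above \<open>x\<close> at the entry time, continuity would put it
  above \<open>x\<close> slightly earlier, against minimality; \<open>f 0 \<le> x\<close> ensures
  that there is an earlier time.\<close>

lemma entry_time_value_le:
  assumes f: "continuous_on {0..} f" "f 0 \<le> x" and T: "0 \<le> T"
  shows "f (entry_time f x T) \<le> x"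
proof (rule ccontr)
  let ?t = "entry_time f x T"
  assume gt: "\<not> ?thesis"
  moreover have t0: "0 \<le> ?t" by (rule entry_time_nonneg[OF T])
  ultimately obtain d where d: "d > 0" "\<And>r. 0 \<le> r \<Longrightarrow> \<bar>r - ?t\<bar> < d \<Longrightarrow> x < f r"
    using continuous_on_gt_right[OF f(1) t0, of x] by (auto simp: not_le)
  have "0 < ?t" using gt f(2) t0 by (cases "?t = 0") auto
  define r where "r = max 0 (?t - d / 2)"
  have "x < f r" by (rule d(2)) (use d(1) \<open>0 < ?t\<close> in \<open>auto simp: r_def\<close>)
  then have "?t \<le> r" by (intro entry_time_lower[OF T]) (auto simp: r_def)
  then show False using \<open>0 < ?t\<close> d(1) by (auto simp: r_def)
qed

text \<open>An entry before the horizon is a limit of exceedance times from the right, so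
  \<open>f\<close> cannot be strictly below \<open>x\<close> there.\<close>

lemma entry_time_value_eq:
  assumes f: "continuous_on {0..} f" "f 0 \<le> x" and T: "0 \<le> T" "entry_time f x T < T"
  shows "f (entry_time f x T) = x"
proof (rule antisym[OF entry_time_value_le[OF f T(1)]], rule ccontr)
  let ?t = "entry_time f x T"
  assume "\<not> x \<le> f ?t"
  then have lt: "- x < - f ?t" by auto
  have t0: "0 \<le> ?t" by (rule entry_time_nonneg[OF T(1)])
  have "continuous_on {0..} (\<lambda>r. - f r)" using f(1) by (intro continuous_intros)
  from continuous_on_gt_right[OF this t0 lt] obtain d
    where d: "d > 0" "\<And>r. 0 \<le> r \<Longrightarrow> \<bar>r - ?t\<bar> < d \<Longrightarrow> f r < x" by auto
  \<comment> \<open>The minimum with \<open>T\<close> rules out the alternative that the infimum is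
    attained by the horizon, so an actual exceedance results.\<close>
  have "?t < min T (?t + d)" using d(1) T(2) by auto
  then obtain s where s: "0 \<le> s" "s < ?t + d" "x < f s"
    using entry_time_less_iff[OF T(1), of f x "min T (?t + d)"] by auto
  then have "?t \<le> s" by (intro entry_time_lower[OF T(1)])
  then have "f s < x" using s by (intro d(2)) auto
  then show False using s by auto
qed

section \<open>Approximation of entry times along grids\<close>

lemma grid_index_le: "grid_index f x h K \<le> K"
  unfolding grid_index_def by (rule Least_le) auto

lemma grid_index_prop: "K \<le> grid_index f x h K \<or> x < f (real (grid_index f x h K) * h)"
  unfolding grid_index_def by (rule LeastI[of _ K]) auto

lemma grid_index_lower: "x < f (real k * h) \<Longrightarrow> grid_index f x h K \<le> k"
  unfolding grid_index_def by (rule Least_le) auto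

lemma grid_index_0 [simp]: "grid_index f x h 0 = 0"
  using grid_index_le[of f x h 0] by simp

text \<open>The index moves only while the path has stayed at or below \<open>x\<close> through step
  \<open>K\<close>. The value at \<open>Suc K\<close> is irrelevant, since an exceedance there and
  the cap both give \<open>Suc K\<close>; hence the decision to continue uses only the past.\<close>

lemma grid_index_Suc:
  "grid_index f x h (Suc K) =
     (if \<forall>j\<le>K. f (real j * h) \<le> x then Suc K else grid_index f x h K)"
proof (cases "\<forall>j\<le>K. f (real j * h) \<le> x")
  case True
  then show ?thesis
    using grid_index_prop[of "Suc K" f x h] grid_index_le[of f x h "Suc K"]
    by (auto simp: le_Suc_eq not_le)
next
  case False
  then obtain j where j: "j \<le> K" "x < f (real j * h)" by auto
  have 1: "grid_index f x h (Suc K) \<le> j" "grid_index f x h K \<le> j"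
    using j by (auto intro: grid_index_lower)
  then have "x < f (real (grid_index f x h (Suc K)) * h)"
    using grid_index_prop[of "Suc K" f x h] j(1) by auto
  then have a: "grid_index f x h K \<le> grid_index f x h (Suc K)" by (rule grid_index_lower)
  have b: "x < f (real (grid_index f x h K) * h)"
    using grid_index_prop[of "K" f x h] 1 j
    by (metis le_antisym order.trans)
  then have "grid_index f x h (Suc K) \<le> grid_index f x h K" by (rule grid_index_lower)
  with a False show ?thesis by auto
qed

lemma grid_index_eq: "\<forall>j\<le>K. f (real j * h) \<le> x \<Longrightarrow> grid_index f x h K = K"
  using grid_index_prop[of K f x h] grid_index_le[of f x h K] by (auto simp: le_antisym not_le)

text \<open>Grid times never precede the entry time. Conversely, near an exceedance shortly after
  the entry time the path stays above \<open>x\<close> on a whole interval, which a fine enough grid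
  must hit.\<close>

lemma grid_index_tendsto:
  assumes f: "continuous_on {0..} f" and T: "0 < T"
  shows "(\<lambda>N. real (grid_index f x (T / real (Suc N)) (Suc N)) * (T / real (Suc N)))
           \<longlonglongrightarrow> entry_time f x T"
proof (rule LIMSEQ_I)
  fix e :: real assume e: "e > 0"
  let ?t = "entry_time f x T"
  let ?g = "\<lambda>N. real (grid_index f x (T / real (Suc N)) (Suc N)) * (T / real (Suc N))"
  have leT: "?g N \<le> T" for N
  proof -
    have "?g N \<le> real (Suc N) * (T / real (Suc N))"
      using T grid_index_le[of f x "T / real (Suc N)" "Suc N"]
      by (intro mult_right_mono) (simp_all only: of_nat_le_iff, auto)
    then show ?thesis by simp
  qed
  have ge: "?t \<le> ?g N" for N
  proof (cases "x < f (?g N)")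
    case True
    then show ?thesis using T by (intro entry_time_lower) auto
  next
    case False
    then have "Suc N \<le> grid_index f x (T / real (Suc N)) (Suc N)"
      using grid_index_prop[of "Suc N" f x "T / real (Suc N)"] by auto
    then have "grid_index f x (T / real (Suc N)) (Suc N) = Suc N"
      using grid_index_le by (metis le_antisym)
    then show ?thesis using entry_time_le[of T f x] T by simp
  qed
  have "\<exists>N0. \<forall>N\<ge>N0. ?g N < ?t + e"
  proof (cases "T < ?t + e")
    case True
    then show ?thesis using leT by (meson le_less_trans)
  next
    case False
    then obtain s where s: "0 \<le> s" "s < ?t + e" "x < f s"
      using entry_time_less_iff[of T f x "?t + e"] e T by auto
    obtain d where d: "d > 0" "\<And>r. 0 \<le> r \<Longrightarrow> \<bar>r - s\<bar> < d \<Longrightarrow> x < f r"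
      using continuous_on_gt_right[OF f s(1,3)] by auto
    \<comment> \<open>With mesh \<open>h < m\<close>, the first grid point at or after
      \<open>s\<close> is closer than \<open>d\<close> to \<open>s\<close>, so \<open>f\<close>
      exceeds \<open>x\<close> there, and it still lies before \<open>?t + e\<close>.\<close>
    define m where "m = min d (?t + e - s)"
    have m: "m > 0" using d s by (auto simp: m_def)
    obtain N0 :: nat where N0: "T / m < real N0" using reals_Archimedean2 by blast
    have "?g N < ?t + e" if N: "N \<ge> N0" for N
    proof -
      define h where "h = T / real (Suc N)"
      have h: "h > 0" using T by (auto simp: h_def)
      have "T / m < real (Suc N)" using N0 N by (auto)
      then have hm: "h < m" using m T by (auto simp: h_def field_simps)
      define k where "k = nat \<lceil>s / h\<rceil>"
      have "0 \<le> s / h" using s h by auto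
      then have k: "s / h \<le> real k" "real k < s / h + 1" unfolding k_def by linarith+
      have kh: "s \<le> real k * h" "real k * h < s + h"
        using k h by (auto simp: field_simps)
      have "x < f (real k * h)" using kh hm s(1) h by (intro d(2)) (auto simp: m_def)
      then have "grid_index f x h (Suc N) \<le> k" by (rule grid_index_lower)
      then have "real (grid_index f x h (Suc N)) * h \<le> real k * h"
        using h by (intro mult_right_mono) auto
      also have "\<dots> < ?t + e" using kh hm by (auto simp: m_def)
      finally show ?thesis by (simp add: h_def)
    qed
    then show ?thesis by blast
  qed
  then show "\<exists>N0. \<forall>N\<ge>N0. norm (?g N - ?t) < e"
    using ge by (smt (verit) real_norm_def)
qed

section \<open>Removal of the horizon\<close>

lemma entry_time_eq_Inf:
  assumes "\<exists>s\<ge>0. x < f s" "Inf {s. 0 \<le> s \<and> x < f s} \<le> T"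
  shows "entry_time f x T = Inf {s. 0 \<le> s \<and> x < f s}"
proof -
  have "bdd_below {s. 0 \<le> s \<and> x < f s}" by (intro bdd_belowI[of _ 0]) auto
  then show ?thesis
    using assms unfolding entry_time_def by (subst cInf_insert_If) (auto simp: inf_min)
qed

text \<open>This gives the measurability of \<open>entry_discount\<close>. The sequence is
  eventually constant if the path ever exceeds \<open>x\<close>; otherwise the entry time is the
  horizon \<open>n\<close> itself.\<close>

lemma exp_neg_entry_time_tendsto:
  "(\<lambda>n. exp (- entry_time f x (real n))) \<longlonglongrightarrow> entry_discount f x"
proof (cases "\<exists>s\<ge>0. x < f s")
  case True
  obtain N :: nat where N: "Inf {s. 0 \<le> s \<and> x < f s} \<le> real N" using real_arch_simple by blast
  have "eventually (\<lambda>n. exp (- entry_time f x (real n)) = entry_discount f x) sequentially"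
    using eventually_ge_at_top[of N]
  proof eventually_elim
    case (elim n)
    then show ?case using N True
      by (subst entry_time_eq_Inf) (auto simp: entry_discount_def)
  qed
  then show ?thesis by (rule tendsto_eventually)
next
  case False
  then have no: "{s. 0 \<le> s \<and> x < f s} = {}" by auto
  have "entry_time f x (real n) = real n" for n unfolding entry_time_def no by simp
  moreover have "(\<lambda>n. exp (- real n)) \<longlonglongrightarrow> 0"
    by (intro filterlim_compose[OF exp_at_bot] filterlim_compose[OF filterlim_uminus_at_bot_at_top]
        filterlim_real_sequentially)
  moreover have "entry_discount f x = 0" unfolding entry_discount_def using False by auto
  ultimately show ?thesis by simp
qed

text \<open>A path that exceeds \<open>x\<close> sits exactly at \<open>x\<close> when it enters,
  and the sequence is eventually constant. A path that never does satisfies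
  \<open>a * f n \<le> a * x\<close>, so the discount with rate \<open>l > 0\<close> drives the
  sequence to \<open>0\<close>.\<close>

lemma exp_entry_time_tendsto:
  assumes f: "continuous_on {0..} f" "f 0 \<le> x" and x: "0 < x" and a: "0 \<le> a" and l: "0 < l"
  shows "(\<lambda>n. exp (a * f (entry_time f x (real n)) - real l * entry_time f x (real n)))
           \<longlonglongrightarrow> exp (a * x) * entry_discount f x ^ l"
proof (cases "\<exists>s\<ge>0. x < f s")
  case True
  obtain N :: nat where N: "Inf {s. 0 \<le> s \<and> x < f s} < real N" using reals_Archimedean2 by blast
  have "eventually (\<lambda>n. exp (a * f (entry_time f x (real n)) - real l * entry_time f x (real n))
     = exp (a * x) * entry_discount f x ^ l) sequentially"
    using eventually_ge_at_top[of N]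
  proof eventually_elim
    case (elim n)
    have *: "entry_time f x (real n) = Inf {s. 0 \<le> s \<and> x < f s}"
      using elim N True by (intro entry_time_eq_Inf) auto
    moreover have "f (entry_time f x (real n)) = x"
      using * elim N by (intro entry_time_value_eq f) auto
    ultimately show ?case using True
      by (simp add: entry_discount_def exp_diff exp_minus power_inverse field_simps
          flip: exp_of_nat_mult)
  qed
  then show ?thesis by (rule tendsto_eventually)
next
  case False
  then have no: "{s. 0 \<le> s \<and> x < f s} = {}" by auto
  have "(\<lambda>n. exp (- real n)) \<longlonglongrightarrow> 0"
    by (intro filterlim_compose[OF exp_at_bot] filterlim_compose[OF filterlim_uminus_at_bot_at_top]
        filterlim_real_sequentially)
  then have lim: "(\<lambda>n. exp (a * x) * exp (- real n)) \<longlonglongrightarrow> exp (a * x) * 0"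
    by (intro tendsto_intros)
  have "(\<lambda>n. exp (a * f (entry_time f x (real n)) - real l * entry_time f x (real n))) \<longlonglongrightarrow> 0"
  proof (rule tendsto_sandwich[OF _ _ tendsto_const])
    have "exp (a * f (entry_time f x (real n)) - real l * entry_time f x (real n)) 
        \<le> exp (a * x) * exp (- real n)" for n
    proof -
      have e: "entry_time f x (real n) = real n" unfolding entry_time_def no by simp
      have "a * f (real n) \<le> a * x" using False a by (intro mult_left_mono) (auto simp: not_less)
      moreover have "real n \<le> real l * real n" using l by (cases l) (auto simp: field_simps)
      ultimately show ?thesis unfolding e exp_add[symmetric] by simp
    qed
    then show "eventually (\<lambda>n. exp (a * f (entry_time f x (real n)) - real l * entry_time f x (real n)) 
        \<le> exp (a * x) * exp (- real n)) sequentially" by simp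
    show "(\<lambda>n. exp (a * x) * exp (- real n)) \<longlonglongrightarrow> 0" using lim by simp
  qed auto
  moreover have "entry_discount f x = 0" unfolding entry_discount_def using False by auto
  ultimately show ?thesis using l by (simp add: power_0_left)
qed

lemma entry_discount_bounds: "0 \<le> entry_discount f x \<and> entry_discount f x \<le> 1"
proof -
  have "0 \<le> Inf {s. 0 \<le> s \<and> x < f s}" if "\<exists>s\<ge>0. x < f s"
    using that by (intro cInf_greatest) auto
  then show ?thesis by (auto simp: entry_discount_def)
qed

text \<open>Strict inequality on the left matches the closed interval on the right: an exceedance at
  \<open>t\<close> itself persists slightly to the left of \<open>t\<close>, so the entry comes
  strictly before \<open>t\<close>.\<close>

lemma entry_discount_gt_iff:
  assumes f: "continuous_on {0..} f" and t: "0 < t"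
  shows "exp (- t) < entry_discount f x \<longleftrightarrow> (\<exists>s\<in>{0..t}. x < f s)"
proof
  assume *: "exp (- t) < entry_discount f x"
  then have ex: "\<exists>s\<ge>0. x < f s" by (auto simp: entry_discount_def split: if_splits)
  with * have "Inf {s. 0 \<le> s \<and> x < f s} < t" by (auto simp: entry_discount_def)
  moreover have "bdd_below {s. 0 \<le> s \<and> x < f s}" by (intro bdd_belowI[of _ 0]) auto
  ultimately obtain s where "0 \<le> s" "x < f s" "s < t"
    using ex by (subst (asm) cInf_less_iff) auto
  then show "\<exists>s\<in>{0..t}. x < f s" by auto
next
  assume "\<exists>s\<in>{0..t}. x < f s"
  then obtain s where s: "0 \<le> s" "s \<le> t" "x < f s" by auto
  then obtain d where d: "d > 0" "\<And>r. 0 \<le> r \<Longrightarrow> \<bar>r - s\<bar> < d \<Longrightarrow> x < f r"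
    using continuous_on_gt_right[OF f] by metis
  define r where "r = (if s < t then s else max 0 (t - d / 2))"
  have r: "0 \<le> r" "r < t" "x < f r" using s d t by (auto simp: r_def)
  have "Inf {s. 0 \<le> s \<and> x < f s} \<le> r"
    using r by (intro cInf_lower bdd_belowI[of _ 0]) auto
  then show "exp (- t) < entry_discount f x" using r by (auto simp: entry_discount_def)
qed

text \<open>Entry at exactly \<open>t\<close> places the path at level \<open>x\<close>. This
  confines the boundary case to an event concerning the single time \<open>t\<close>.\<close>

lemma entry_discount_eqD:
  assumes f: "continuous_on {0..} f" "f 0 \<le> x" and eq: "entry_discount f x = exp (- t)"
  shows "f t = x"
proof -
  have ex: "\<exists>s\<ge>0. x < f s" using eq by (auto simp: entry_discount_def split: if_splits)
  with eq have I: "Inf {s. 0 \<le> s \<and> x < f s} = t" by (auto simp: entry_discount_def)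
  have "0 \<le> t" using ex unfolding I[symmetric] by (intro cInf_greatest) auto
  have "entry_time f x (t + 1) = t" using I ex by (subst entry_time_eq_Inf) auto
  then show ?thesis using entry_time_value_eq[OF f, of "t + 1"] \<open>0 \<le> t\<close> by auto
qed

lemma less_Sup_image_iff:
  fixes f :: "real \<Rightarrow> real"
  assumes "continuous_on {0..} f" "0 \<le> t"
  shows "x < Sup (f ` {0..t}) \<longleftrightarrow> (\<exists>s\<in>{0..t}. x < f s)"
proof -
  have "compact (f ` {0..t})"
    by (intro compact_continuous_image continuous_on_subset[OF assms(1)]) auto
  then show ?thesis
    using assms(2) by (subst less_cSup_iff) (auto dest: compact_imp_bounded bounded_imp_bdd_above)
qed

section \<open>Moments determine laws on the half-open unit interval\<close>

text \<open>Only moments of positive order are compared, because the laws may have different masses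
  at \<open>0\<close>, up to the factor \<open>c\<close>. The test functions therefore carry a
  factor that vanishes at \<open>0\<close>, and Weierstrass approximation is applied to
  \<open>g\<close> alone.\<close>

lemma integral_times_continuous_eq_of_moments:
  fixes Y :: "'a \<Rightarrow> real" and Z :: "'b \<Rightarrow> real" and g :: "real \<Rightarrow> real"
  assumes "prob_space M" "prob_space N"
    and Y [measurable]: "Y \<in> borel_measurable M" and Z [measurable]: "Z \<in> borel_measurable N"
    and Yb: "\<And>\<omega>. \<omega> \<in> space M \<Longrightarrow> Y \<omega> \<in> {0..1}" and Zb: "\<And>\<omega>. \<omega> \<in> space N \<Longrightarrow> Z \<omega> \<in> {0..1}"
    and mom: "\<And>n::nat. n > 0 \<Longrightarrow> (\<integral>\<omega>. Y \<omega> ^ n \<partial>M) = c * (\<integral>\<omega>. Z \<omega> ^ n \<partial>N)"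
    and g: "continuous_on {0..1} g" and [measurable]: "g \<in> borel_measurable borel"
  shows "(\<integral>\<omega>. Y \<omega> * g (Y \<omega>) \<partial>M) = c * (\<integral>\<omega>. Z \<omega> * g (Z \<omega>) \<partial>N)"
proof -
  interpret M: prob_space M by fact
  interpret N: prob_space N by fact
  obtain b where b: "\<And>y. y \<in> {0..1} \<Longrightarrow> \<bar>g y\<bar> \<le> b"
  proof -
    have "bounded (g ` {0..1})" by (intro compact_imp_bounded compact_continuous_image g compact_Icc)
    then obtain b where "\<forall>y\<in>{0..1}. \<bar>g y\<bar> \<le> b" by (auto simp: bounded_iff)
    then show thesis by (intro that[of b]) auto
  qed
  have YI: "integrable M (\<lambda>\<omega>. Y \<omega> ^ n)" for n
    using Yb by (intro M.integrable_const_bound[where B=1]) (auto intro!: AE_I2 simp: power_le_one)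
  have ZI: "integrable N (\<lambda>\<omega>. Z \<omega> ^ n)" for n
    using Zb by (intro N.integrable_const_bound[where B=1]) (auto intro!: AE_I2 simp: power_le_one)
  have gI: "integrable M (\<lambda>\<omega>. Y \<omega> * g (Y \<omega>))"
    using Yb b by (intro M.integrable_const_bound[where B=b])
      (auto intro!: AE_I2 mult_le_one simp: abs_mult intro: order.trans[OF mult_left_le_one_le])
  have gI': "integrable N (\<lambda>\<omega>. Z \<omega> * g (Z \<omega>))"
    using Zb b by (intro N.integrable_const_bound[where B=b])
      (auto intro!: AE_I2 mult_le_one simp: abs_mult intro: order.trans[OF mult_left_le_one_le])
  have close: "\<bar>(\<integral>\<omega>. Y \<omega> * g (Y \<omega>) \<partial>M) - c * (\<integral>\<omega>. Z \<omega> * g (Z \<omega>) \<partial>N)\<bar> \<le> e * (1 + \<bar>c\<bar>)"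
    if e: "e > 0" for e
  proof -
    obtain p where p: "real_polynomial_function p" "\<And>y. y \<in> {0..1} \<Longrightarrow> \<bar>g y - p y\<bar> < e"
      using Stone_Weierstrass_real_polynomial_function[OF compact_Icc g e] by blast
    obtain a n where a: "p = (\<lambda>x. \<Sum>i\<le>n. a i * x ^ i)"
      using real_polynomial_function_imp_sum[OF p(1)] by blast
    \<comment> \<open>The factor \<open>y\<close> raises every monomial to positive order, where
      \<open>mom\<close> applies.\<close>
    have pe: "y * p y = (\<Sum>i\<le>n. a i * y ^ Suc i)" for y
      unfolding a by (simp add: sum_distrib_left algebra_simps)
    have pI: "integrable M (\<lambda>\<omega>. Y \<omega> * p (Y \<omega>))" "integrable N (\<lambda>\<omega>. Z \<omega> * p (Z \<omega>))"
      unfolding pe using YI ZI by (auto intro!: Bochner_Integration.integrable_sum simp del: power_Suc)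
    have eq: "(\<integral>\<omega>. Y \<omega> * p (Y \<omega>) \<partial>M) = c * (\<integral>\<omega>. Z \<omega> * p (Z \<omega>) \<partial>N)"
      unfolding pe using YI ZI mom
      by (subst (1 2) Bochner_Integration.integral_sum)
         (auto simp del: power_Suc simp: sum_distrib_left algebra_simps intro!: sum.cong)
    have bd: "\<bar>y * g y - y * p y\<bar> \<le> e" if "y \<in> {0..1}" for y
    proof -
      have "\<bar>y * g y - y * p y\<bar> = y * \<bar>g y - p y\<bar>"
        using that by (simp add: abs_mult flip: right_diff_distrib)
      also have "\<dots> \<le> 1 * e" using that p(2)[OF that] by (intro mult_mono) auto
      finally show ?thesis by simp
    qed
    have 1: "\<bar>(\<integral>\<omega>. Y \<omega> * g (Y \<omega>) \<partial>M) - (\<integral>\<omega>. Y \<omega> * p (Y \<omega>) \<partial>M)\<bar> \<le> e"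
    proof -
      have "\<bar>\<integral>\<omega>. Y \<omega> * g (Y \<omega>) - Y \<omega> * p (Y \<omega>) \<partial>M\<bar> \<le> (\<integral>\<omega>. \<bar>Y \<omega> * g (Y \<omega>) - Y \<omega> * p (Y \<omega>)\<bar> \<partial>M)"
        by (rule integral_abs_bound)
      also have "\<dots> \<le> e" using bd Yb gI pI by (intro M.integral_le_const) auto
      finally show ?thesis using gI pI by simp
    qed
    have 2: "\<bar>(\<integral>\<omega>. Z \<omega> * g (Z \<omega>) \<partial>N) - (\<integral>\<omega>. Z \<omega> * p (Z \<omega>) \<partial>N)\<bar> \<le> e"
    proof -
      have "\<bar>\<integral>\<omega>. Z \<omega> * g (Z \<omega>) - Z \<omega> * p (Z \<omega>) \<partial>N\<bar> \<le> (\<integral>\<omega>. \<bar>Z \<omega> * g (Z \<omega>) - Z \<omega> * p (Z \<omega>)\<bar> \<partial>N)"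
        by (rule integral_abs_bound)
      also have "\<dots> \<le> e" using bd Zb gI' pI by (intro N.integral_le_const) auto
      finally show ?thesis using gI' pI by simp
    qed
    have 3: "\<bar>c * (\<integral>\<omega>. Z \<omega> * g (Z \<omega>) \<partial>N) - c * (\<integral>\<omega>. Z \<omega> * p (Z \<omega>) \<partial>N)\<bar> \<le> \<bar>c\<bar> * e"
      using mult_left_mono[OF 2, of "\<bar>c\<bar>"] by (simp add: abs_mult flip: right_diff_distrib)
    show ?thesis using 1 3 unfolding eq by (simp add: algebra_simps)
  qed
  show ?thesis
  proof (rule ccontr)
    assume "\<not> ?thesis"
    then have "0 < \<bar>(\<integral>\<omega>. Y \<omega> * g (Y \<omega>) \<partial>M) - c * (\<integral>\<omega>. Z \<omega> * g (Z \<omega>) \<partial>N)\<bar>" (is "0 < ?D") by auto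
    \<comment> \<open>\<open>close\<close> is used with \<open>e\<close> chosen so that its bound is
      half of \<open>?D\<close>.\<close>
    then have "?D \<le> ?D / (2 * (1 + \<bar>c\<bar>)) * (1 + \<bar>c\<bar>)" by (intro close) auto
    also have "\<dots> = ?D / 2" by (simp add: field_simps add_pos_nonneg)
    finally show False using \<open>0 < ?D\<close> by auto
  qed
qed

text \<open>The indicator of \<open>{b..}\<close> is a bounded pointwise limit of functions of the
  form \<open>y * g y\<close> with \<open>g\<close> continuous.\<close>

lemma prob_ge_eq_of_moments:
  fixes Y :: "'a \<Rightarrow> real" and Z :: "'b \<Rightarrow> real"
  assumes M: "prob_space M" and N: "prob_space N"
    and Y [measurable]: "Y \<in> borel_measurable M" and Z [measurable]: "Z \<in> borel_measurable N"
    and Yb: "\<And>\<omega>. \<omega> \<in> space M \<Longrightarrow> Y \<omega> \<in> {0..1}" and Zb: "\<And>\<omega>. \<omega> \<in> space N \<Longrightarrow> Z \<omega> \<in> {0..1}"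
    and mom: "\<And>n::nat. n > 0 \<Longrightarrow> (\<integral>\<omega>. Y \<omega> ^ n \<partial>M) = c * (\<integral>\<omega>. Z \<omega> ^ n \<partial>N)"
    and b: "0 < b"
  shows "measure M {\<omega>\<in>space M. b \<le> Y \<omega>} = c * measure N {\<omega>\<in>space N. b \<le> Z \<omega>}"
proof -
  \<comment> \<open>For \<open>k > 0\<close> the numerator is a ramp rising from \<open>0\<close> at
    \<open>b - 1 / k\<close> to \<open>1\<close> at \<open>b\<close>. Dividing by
    \<open>max y b\<close> makes \<open>y * f k y\<close> equal to \<open>1\<close> for
    \<open>y \<ge> b\<close>, and \<open>b > 0\<close> keeps the denominator away from
    \<open>0\<close>.\<close>
  define f :: "nat \<Rightarrow> real \<Rightarrow> real"
    where "f k y = max 0 (min 1 (1 - real k * (b - y))) / max y b" for k y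
  have cont: "continuous_on UNIV (f k)" for k
    unfolding f_def using b by (intro continuous_intros) (auto simp: max_def)
  then have [measurable]: "f k \<in> borel_measurable borel" for k
    by (rule borel_measurable_continuous_onI)
  have eq: "(\<integral>\<omega>. Y \<omega> * f k (Y \<omega>) \<partial>M) = c * (\<integral>\<omega>. Z \<omega> * f k (Z \<omega>) \<partial>N)" for k
    using cont[of k] by (intro integral_times_continuous_eq_of_moments assms)
      (auto intro: continuous_on_subset)
  have lim: "(\<lambda>k. y * f k y) \<longlonglongrightarrow> indicator {b..} y" if "y \<in> {0..1}" for y
  proof (cases "b \<le> y")
    case True
    then have "real k * (b - y) \<le> 0" for k by (intro mult_nonneg_nonpos) auto
    then have "y * f k y = 1" for k
      using True b by (auto simp: f_def min_def max_def not_le algebra_simps)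
    then show ?thesis using True by simp
  next
    case False
    obtain K :: nat where K: "1 / (b - y) \<le> real K" using real_arch_simple by blast
    have "eventually (\<lambda>k. y * f k y = 0) sequentially" using eventually_ge_at_top[of K]
    proof eventually_elim
      case (elim k)
      then have "1 / (b - y) \<le> real k" using K by linarith
      then have "1 \<le> real k * (b - y)" using False by (auto simp: field_simps)
      then show ?case by (auto simp: f_def)
    qed
    then show ?thesis using False by (auto intro: tendsto_eventually)
  qed
  have bd: "\<bar>y * f k y\<bar> \<le> 1" if "y \<in> {0..1}" for k y
  proof -
    have "y * f k y = (y / max y b) * max 0 (min 1 (1 - real k * (b - y)))" by (simp add: f_def)
    also have "\<bar>\<dots>\<bar> \<le> 1 * 1" unfolding abs_mult
      using that b by (intro mult_mono) auto
    finally show ?thesis by simp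
  qed
  have limX: "(\<lambda>k. \<integral>\<omega>. X \<omega> * f k (X \<omega>) \<partial>L) \<longlonglongrightarrow> measure L {\<omega>\<in>space L. b \<le> X \<omega>}"
    if L: "prob_space L" and [measurable]: "X \<in> borel_measurable L"
      and Xb: "\<And>\<omega>. \<omega> \<in> space L \<Longrightarrow> X \<omega> \<in> {0..1}" for L :: "'z measure" and X
  proof -
    interpret prob_space L by fact
    have "(\<lambda>k. \<integral>\<omega>. X \<omega> * f k (X \<omega>) \<partial>L) \<longlonglongrightarrow> (\<integral>\<omega>. indicator {b..} (X \<omega>) \<partial>L)"
      using lim bd Xb by (intro integral_dominated_convergence[where w="\<lambda>_. 1"]) (auto intro!: AE_I2)
    also have "(\<integral>\<omega>. indicat_real {b..} (X \<omega>) \<partial>L) = (\<integral>\<omega>. indicat_real {\<omega>\<in>space L. b \<le> X \<omega>} \<omega> \<partial>L)"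
      by (intro Bochner_Integration.integral_cong) (auto simp: indicator_def)
    finally show ?thesis by simp
  qed
  have "(\<lambda>k. \<integral>\<omega>. Y \<omega> * f k (Y \<omega>) \<partial>M) \<longlonglongrightarrow> c * measure N {\<omega>\<in>space N. b \<le> Z \<omega>}"
    unfolding eq by (intro tendsto_mult_left limX N Z Zb)
  then show ?thesis using limX[OF M Y Yb] LIMSEQ_unique by blast
qed

lemma (in prob_space) prob_gt_LIMSEQ:
  assumes [measurable]: "X \<in> borel_measurable M"
  shows "(\<lambda>n. measure M {\<omega>\<in>space M. b + inverse (real (Suc n)) \<le> X \<omega>})
           \<longlonglongrightarrow> measure M {\<omega>\<in>space M. b < X \<omega>}"
proof -
  let ?A = "\<lambda>n. {\<omega>\<in>space M. b + inverse (real (Suc n)) \<le> X \<omega>}"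
  have "inverse (real (Suc n)) \<le> inverse (real (Suc m))" if "m \<le> n" for m n
    using that by simp
  then have "incseq ?A" unfolding incseq_def by (fastforce intro: order.trans[rotated])
  then have "(\<lambda>n. measure M (?A n)) \<longlonglongrightarrow> measure M (\<Union>n. ?A n)"
    by (intro finite_Lim_measure_incseq) auto
  also have "(\<Union>n. ?A n) = {\<omega>\<in>space M. b < X \<omega>}"
  proof -
    have "b < y" if "b + inverse (real (Suc n)) \<le> y" for y n
    proof -
      have "0 < inverse (real (Suc n))" by simp
      with that show ?thesis by linarith
    qed
    moreover have "\<exists>n. b + inverse (real (Suc n)) \<le> y" if "b < y" for y
      using reals_Archimedean[of "y - b"] that by (auto simp: algebra_simps intro: less_imp_le)
    ultimately show ?thesis by blast
  qed
  finally show ?thesis .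
qed

text \<open>An open half-line is an increasing union of closed ones with end points
  \<open>b + 1 / (n + 1)\<close>, which are positive even for \<open>b = 0\<close>.\<close>

lemma prob_gt_eq_of_moments:
  fixes Y :: "'a \<Rightarrow> real" and Z :: "'b \<Rightarrow> real"
  assumes M: "prob_space M" and N: "prob_space N"
    and Y: "Y \<in> borel_measurable M" and Z: "Z \<in> borel_measurable N"
    and Yb: "\<And>\<omega>. \<omega> \<in> space M \<Longrightarrow> Y \<omega> \<in> {0..1}" and Zb: "\<And>\<omega>. \<omega> \<in> space N \<Longrightarrow> Z \<omega> \<in> {0..1}"
    and mom: "\<And>n::nat. n > 0 \<Longrightarrow> (\<integral>\<omega>. Y \<omega> ^ n \<partial>M) = c * (\<integral>\<omega>. Z \<omega> ^ n \<partial>N)"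
    and b: "0 \<le> b"
  shows "measure M {\<omega>\<in>space M. b < Y \<omega>} = c * measure N {\<omega>\<in>space N. b < Z \<omega>}"
proof (rule LIMSEQ_unique)
  have "measure M {\<omega>\<in>space M. b + inverse (real (Suc n)) \<le> Y \<omega>} =
      c * measure N {\<omega>\<in>space N. b + inverse (real (Suc n)) \<le> Z \<omega>}" for n
    using b by (intro prob_ge_eq_of_moments assms add_nonneg_pos) auto
  then show "(\<lambda>n. measure M {\<omega>\<in>space M. b + inverse (real (Suc n)) \<le> Y \<omega>})
      \<longlonglongrightarrow> c * measure N {\<omega>\<in>space N. b < Z \<omega>}"
    using tendsto_mult_left[OF prob_space.prob_gt_LIMSEQ[OF N Z, of b], of c] by (simp only:)
  show "(\<lambda>n. measure M {\<omega>\<in>space M. b + inverse (real (Suc n)) \<le> Y \<omega>})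
      \<longlonglongrightarrow> measure M {\<omega>\<in>space M. b < Y \<omega>}"
    by (rule prob_space.prob_gt_LIMSEQ[OF M Y])
qed

section \<open>Exponential martingales of Brownian motion with drift\<close>

text \<open>Completing the square: the exponential factor shifts the mean of the normal density to
  \<open>c * \<sigma>\<^sup>2\<close> and leaves a constant.\<close>

lemma normal_exp_moment:
  assumes "0 < \<sigma>"
  shows "has_bochner_integral lborel (\<lambda>y. normal_density 0 \<sigma> y * exp (c * y)) (exp (c\<^sup>2 * \<sigma>\<^sup>2 / 2))"
proof -
  have "normal_density 0 \<sigma> y * exp (c * y) = exp (c\<^sup>2 * \<sigma>\<^sup>2 / 2) * normal_density (c * \<sigma>\<^sup>2) \<sigma> y" for y
  proof -
    have "- (y - 0)\<^sup>2 / (2 * \<sigma>\<^sup>2) + c * y = c\<^sup>2 * \<sigma>\<^sup>2 / 2 + - (y - c * \<sigma>\<^sup>2)\<^sup>2 / (2 * \<sigma>\<^sup>2)"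
      using assms by (simp add: field_simps power2_eq_square)
    then show ?thesis
      unfolding normal_density_def by (simp add: mult.commute mult.left_commute flip: exp_add)
  qed
  moreover have "has_bochner_integral lborel (\<lambda>y. exp (c\<^sup>2 * \<sigma>\<^sup>2 / 2) * normal_density (c * \<sigma>\<^sup>2) \<sigma> y)
      (exp (c\<^sup>2 * \<sigma>\<^sup>2 / 2) * 1)"
    using assms by (intro has_bochner_integral_mult_right)
      (simp add: has_bochner_integral_iff integrable_normal_density integral_normal_density)
  ultimately show ?thesis by simp
qed

locale brownian_drift = prob_space M for M :: "'a measure" +
  fixes B :: "real \<Rightarrow> 'a \<Rightarrow> real" and \<mu> :: real
  assumes BM: "standard_BM M B"
begin

text \<open>The sample point comes first so that \<open>X \<omega>\<close> is a path, as entry times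
  and grid indices expect.\<close>

definition X :: "'a \<Rightarrow> real \<Rightarrow> real" where "X \<omega> s = - \<mu> * s + sqrt 2 * B s \<omega>"

lemma X_0: "\<omega> \<in> space M \<Longrightarrow> X \<omega> 0 = 0"
  using BM by (simp add: X_def standard_BM_def)

lemma X_cont: "\<omega> \<in> space M \<Longrightarrow> continuous_on {0..} (X \<omega>)"
  using BM unfolding X_def[abs_def] standard_BM_def by (intro continuous_intros) auto

lemma B_measurable: "0 \<le> s \<Longrightarrow> B s \<in> borel_measurable M"
  using BM by (simp add: standard_BM_def)

lemma X_measurable: "0 \<le> s \<Longrightarrow> (\<lambda>\<omega>. X \<omega> s) \<in> borel_measurable M"
  using B_measurable[of s] unfolding X_def[abs_def] by simp

text \<open>The increment is normal with mean \<open>- \<mu> * (t - s)\<close> and variance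
  \<open>2 * (t - s)\<close>. Its Laplace exponent \<open>a\<^sup>2 - \<mu> * a\<close> is the rate
  \<open>l\<close> that turns \<open>exp (a * X \<omega> s - l * s)\<close> into a
  martingale.\<close>

lemma exp_increment:
  assumes "0 \<le> s" "s < t"
  shows "has_bochner_integral M (\<lambda>\<omega>. exp (a * (X \<omega> t - X \<omega> s))) (exp ((a\<^sup>2 - \<mu> * a) * (t - s)))"
proof -
  have D: "distributed M lborel (\<lambda>\<omega>. B t \<omega> - B s \<omega>)
      (\<lambda>x. ennreal (normal_density 0 (sqrt (t - s)) x))"
    using BM assms by (simp add: standard_BM_def)
  have nm: "has_bochner_integral lborel
      (\<lambda>y. normal_density 0 (sqrt (t - s)) y * exp ((a * sqrt 2) * y))
      (exp ((a * sqrt 2)\<^sup>2 * (sqrt (t - s))\<^sup>2 / 2))"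
    using assms by (intro normal_exp_moment) auto
  have "has_bochner_integral M (\<lambda>\<omega>. exp ((a * sqrt 2) * (B t \<omega> - B s \<omega>))) (exp (a\<^sup>2 * (t - s)))"
    using nm distributed_integrable[OF D, of "\<lambda>y. exp ((a * sqrt 2) * y)"]
      distributed_integral[OF D, of "\<lambda>y. exp ((a * sqrt 2) * y)"] assms
    by (simp add: has_bochner_integral_iff power_mult_distrib)
  then have "has_bochner_integral M
      (\<lambda>\<omega>. exp (- a * \<mu> * (t - s)) * exp ((a * sqrt 2) * (B t \<omega> - B s \<omega>)))
      (exp (- a * \<mu> * (t - s)) * exp (a\<^sup>2 * (t - s)))"
    by (intro has_bochner_integral_mult_right)
  moreover have "exp (- a * \<mu> * (t - s)) * exp ((a * sqrt 2) * (B t \<omega> - B s \<omega>))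
      = exp (a * (X \<omega> t - X \<omega> s))" for \<omega>
    unfolding exp_add[symmetric] X_def by (simp add: algebra_simps)
  moreover have "exp (- a * \<mu> * (t - s)) * exp (a\<^sup>2 * (t - s)) = exp ((a\<^sup>2 - \<mu> * a) * (t - s))"
    unfolding exp_add[symmetric] by (simp add: algebra_simps)
  ultimately show ?thesis by simp
qed

section \<open>Optional stopping on a grid\<close>

definition stopped :: "real \<Rightarrow> real \<Rightarrow> real \<Rightarrow> real \<Rightarrow> nat \<Rightarrow> 'a \<Rightarrow> real" where
  "stopped a l x h k \<omega> =
     exp (a * X \<omega> (real (grid_index (X \<omega>) x h k) * h) - l * (real (grid_index (X \<omega>) x h k) * h))"

text \<open>The exponential martingale at step \<open>k\<close>, set to \<open>0\<close> once an
  exceedance has been seen. It is the predictable factor in the increment of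
  \<open>stopped\<close>.\<close>

definition alive :: "real \<Rightarrow> real \<Rightarrow> real \<Rightarrow> real \<Rightarrow> nat \<Rightarrow> 'a \<Rightarrow> real" where
  "alive a l x h k \<omega> =
     (if \<forall>j\<le>k. X \<omega> (real j * h) \<le> x then exp (a * X \<omega> (real k * h) - l * (real k * h)) else 0)"

text \<open>The stopped process is a martingale transform: each step is a factor determined by the
  path up to step \<open>k\<close>, times a factor built from the next increment alone.\<close>

lemma stopped_Suc:
  "stopped a l x h (Suc k) \<omega> = stopped a l x h k \<omega> +
     alive a l x h k \<omega> * (exp (a * (X \<omega> (real (Suc k) * h) - X \<omega> (real k * h)) - l * h) - 1)"
proof (cases "\<forall>j\<le>k. X \<omega> (real j * h) \<le> x")
  case True
  have "grid_index (X \<omega>) x h (Suc k) = Suc k" "grid_index (X \<omega>) x h k = k"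
    using True by (simp_all add: grid_index_Suc grid_index_eq)
  moreover have "exp (a * X \<omega> (real (Suc k) * h) - l * (real (Suc k) * h)) =
     exp (a * X \<omega> (real k * h) - l * (real k * h)) *
       exp (a * (X \<omega> (real (Suc k) * h) - X \<omega> (real k * h)) - l * h)"
    unfolding exp_add[symmetric] by (simp add: algebra_simps)
  ultimately show ?thesis using True
    by (simp add: stopped_def alive_def right_diff_distrib)
next
  case False
  then have "grid_index (X \<omega>) x h (Suc k) = grid_index (X \<omega>) x h k" "alive a l x h k \<omega> = 0"
    unfolding grid_index_Suc alive_def by auto
  then show ?thesis by (simp add: stopped_def)
qed

lemma alive_le_stopped: "alive a l x h k \<omega> \<le> stopped a l x h k \<omega>"
  by (auto simp: alive_def stopped_def grid_index_eq)

lemma alive_measurable: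
  assumes "0 < h"
  shows "alive a l x h k \<in> borel_measurable M"
proof -
  have [measurable]: "(\<lambda>\<omega>. X \<omega> (real j * h)) \<in> borel_measurable M" for j
    using assms by (intro X_measurable) auto
  show ?thesis unfolding alive_def[abs_def] by measurable
qed

lemma stopped_measurable:
  assumes "0 < h"
  shows "stopped a l x h k \<in> borel_measurable M"
proof (induction k)
  case 0
  have [measurable]: "(\<lambda>\<omega>. X \<omega> 0) \<in> borel_measurable M" by (intro X_measurable) auto
  show ?case unfolding stopped_def[abs_def] by simp
next
  case (Suc k)
  have [measurable]: "(\<lambda>\<omega>. X \<omega> (real j * h)) \<in> borel_measurable M" for j
    using assms by (intro X_measurable) auto
  note [measurable] = Suc alive_measurable[OF assms]
  show ?case unfolding stopped_Suc[abs_def] by measurable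
qed

text \<open>The two variables are functions \<open>F\<close> and \<open>g\<close> of disjoint blocks
  of a family of independent Brownian increments: the first \<open>k\<close>, and the one after
  them.\<close>

lemma indep_alive_increment:
  assumes h: "0 < h"
  shows "indep_var borel (alive a l x h k)
           borel (\<lambda>\<omega>. exp (a * (X \<omega> (real (Suc k) * h) - X \<omega> (real k * h)) - l * h) - 1)"
proof -
  define \<Delta> where "\<Delta> i \<omega> = B (real (Suc i) * h) \<omega> - B (real i * h) \<omega>" for i \<omega>
  have "indep_vars (\<lambda>_. borel) \<Delta> {..<Suc k}"
    using BM h unfolding standard_BM_def \<Delta>_def[abs_def]
    by (elim conjE allE[of _ "Suc k"] allE[of _ "\<lambda>i. real i * h"]) (auto simp: field_simps)
  then have ind: "indep_var
      (PiM {..<k} (\<lambda>_. borel)) (\<lambda>\<omega>. restrict (\<lambda>i. \<Delta> i \<omega>) {..<k})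
      (PiM {k} (\<lambda>_. borel)) (\<lambda>\<omega>. restrict (\<lambda>i. \<Delta> i \<omega>) {k})"
    by (rule indep_var_restrict) auto
  \<comment> \<open>\<open>S j\<close> rebuilds \<open>X \<omega> (real j * h)\<close> from the
    increments; this uses that the path starts at \<open>0\<close>.\<close>
  define S where "S j y = (\<Sum>i<j. - \<mu> * h + sqrt 2 * y i)" for j :: nat and y :: "nat \<Rightarrow> real"
  define F where "F y = (if \<forall>j\<le>k. S j y \<le> x then exp (a * S k y - l * (real k * h)) else 0)" for y
  define g where "g y = exp (a * (- \<mu> * h + sqrt 2 * y k) - l * h) - 1" for y :: "nat \<Rightarrow> real"
  have S_meas: "S j \<in> borel_measurable (PiM {..<k} (\<lambda>_. borel))" if "j \<le> k" for j
    unfolding S_def[abs_def] using that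
    by (intro borel_measurable_sum borel_measurable_add borel_measurable_times
        borel_measurable_const measurable_component_singleton) auto
  have "{y \<in> space (PiM {..<k} (\<lambda>_. borel)). \<forall>j\<in>{..k}. S j y \<le> x} \<in> sets (PiM {..<k} (\<lambda>_. borel))"
    using S_meas by (intro sets.sets_Collect_finite_All' borel_measurable_le borel_measurable_const) auto
  moreover have "(\<lambda>y. exp (a * S k y - l * (real k * h))) \<in> borel_measurable (PiM {..<k} (\<lambda>_. borel))"
    using S_meas[OF order_refl] by measurable
  ultimately have F: "F \<in> borel_measurable (PiM {..<k} (\<lambda>_. borel))"
    unfolding F_def[abs_def] by (intro measurable_If) (simp_all only: atMost_iff Ball_def borel_measurable_const)
  have g: "g \<in> borel_measurable (PiM {k} (\<lambda>_. borel))"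
    unfolding g_def[abs_def] by measurable
  have "indep_var borel (F \<circ> (\<lambda>\<omega>. restrict (\<lambda>i. \<Delta> i \<omega>) {..<k}))
      borel (g \<circ> (\<lambda>\<omega>. restrict (\<lambda>i. \<Delta> i \<omega>) {k}))"
    by (rule indep_var_compose[OF ind F g])
  moreover have "X \<omega> (real j * h) = S j (restrict (\<lambda>i. \<Delta> i \<omega>) {..<k})"
    if "\<omega> \<in> space M" "j \<le> k" for \<omega> j
    using that(2)
  proof (induction j)
    case 0
    then show ?case using X_0[OF that(1)] by (simp add: S_def)
  next
    case (Suc j)
    then show ?case by (simp add: S_def \<Delta>_def X_def algebra_simps)
  qed
  then have "\<omega> \<in> space M \<Longrightarrow>
      (F \<circ> (\<lambda>\<omega>. restrict (\<lambda>i. \<Delta> i \<omega>) {..<k})) \<omega> = alive a l x h k \<omega>" for \<omega>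
    by (auto simp: F_def alive_def)
  moreover have "(g \<circ> (\<lambda>\<omega>. restrict (\<lambda>i. \<Delta> i \<omega>) {k})) =
      (\<lambda>\<omega>. exp (a * (X \<omega> (real (Suc k) * h) - X \<omega> (real k * h)) - l * h) - 1)"
    by (auto simp: g_def \<Delta>_def X_def algebra_simps)
  ultimately show ?thesis
    unfolding indep_var_eq
    by (auto cong: measurable_cong vimage_inter_cong)
qed

text \<open>By induction on \<open>k\<close>: the choice of \<open>l\<close> gives the increment
  factor mean zero, and independence transfers this to its product with
  \<open>alive\<close>.\<close>

lemma stopped_expectation:
  assumes h: "0 < h" and l: "l = a\<^sup>2 - \<mu> * a"
  shows "has_bochner_integral M (stopped a l x h k) 1"
proof (induction k)
  case 0
  have "has_bochner_integral M (\<lambda>_. 1) (1::real)"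
    by (simp add: has_bochner_integral_iff prob_space)
  moreover have "stopped a l x h 0 \<omega> = 1" if "\<omega> \<in> space M" for \<omega>
    using X_0[OF that] by (simp add: stopped_def)
  ultimately show ?case by (simp cong: has_bochner_integral_cong)
next
  case (Suc k)
  let ?Z = "\<lambda>\<omega>. exp (a * (X \<omega> (real (Suc k) * h) - X \<omega> (real k * h)) - l * h) - 1"
  have al: "integrable M (alive a l x h k)"
  proof (rule Bochner_Integration.integrable_bound)
    show "integrable M (stopped a l x h k)" using Suc by (simp add: has_bochner_integral_iff)
    show "alive a l x h k \<in> borel_measurable M" by (rule alive_measurable[OF h])
    show "AE \<omega> in M. norm (alive a l x h k \<omega>) \<le> norm (stopped a l x h k \<omega>)"
      using alive_le_stopped by (auto simp: alive_def stopped_def)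
  qed
  have "has_bochner_integral M
      (\<lambda>\<omega>. exp (- l * h) * exp (a * (X \<omega> (real (Suc k) * h) - X \<omega> (real k * h))))
      (exp (- l * h) * exp ((a\<^sup>2 - \<mu> * a) * (real (Suc k) * h - real k * h)))"
    using h by (intro has_bochner_integral_mult_right exp_increment) auto
  also have "exp (- l * h) * exp ((a\<^sup>2 - \<mu> * a) * (real (Suc k) * h - real k * h)) = 1"
    unfolding exp_add[symmetric] l by (simp add: algebra_simps)
  also have "(\<lambda>\<omega>. exp (- l * h) * exp (a * (X \<omega> (real (Suc k) * h) - X \<omega> (real k * h)))) =
      (\<lambda>\<omega>. exp (a * (X \<omega> (real (Suc k) * h) - X \<omega> (real k * h)) - l * h))"
    unfolding exp_add[symmetric] by (simp add: algebra_simps)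
  finally have Z: "integrable M ?Z" "integral\<^sup>L M ?Z = 0"
    by (auto simp: has_bochner_integral_iff prob_space)
  note ind = indep_alive_increment[OF h, of a l x k]
  have "integrable M (\<lambda>\<omega>. alive a l x h k \<omega> * ?Z \<omega>)"
    by (rule indep_var_integrable[OF ind al Z(1)])
  moreover have "(\<integral>\<omega>. alive a l x h k \<omega> * ?Z \<omega> \<partial>M) = 0"
    using indep_var_lebesgue_integral[OF ind al Z(1)] Z(2) by simp
  ultimately show ?case using Suc
    unfolding stopped_Suc[abs_def] by (simp add: has_bochner_integral_iff)
qed

text \<open>This bound does not depend on the mesh once \<open>k * h\<close> is fixed; it supplies the uniform
  integrability for the passage to continuous time. It holds because the square of the stopped
  martingale for \<open>a\<close> is dominated by the stopped martingale for \<open>2 * a\<close>.\<close>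
lemma stopped_square:
  assumes h: "0 < h" and l: "l = a\<^sup>2 - \<mu> * a"
  shows "integrable M (\<lambda>\<omega>. (stopped a l x h k \<omega>)\<^sup>2)"
    and "(\<integral>\<omega>. (stopped a l x h k \<omega>)\<^sup>2 \<partial>M) \<le> exp (2 * a\<^sup>2 * (real k * h))"
proof -
  define l' where "l' = (2 * a)\<^sup>2 - \<mu> * (2 * a)"
  let ?V = "stopped (2 * a) l' x h k" and ?C = "exp (2 * a\<^sup>2 * (real k * h))"
  have le: "(stopped a l x h k \<omega>)\<^sup>2 \<le> ?C * ?V \<omega>" for \<omega>
  proof -
    define m where "m = real (grid_index (X \<omega>) x h k) * h"
    have "m \<le> real k * h"
      unfolding m_def using h grid_index_le by (intro mult_right_mono) auto
    then have "2 * a\<^sup>2 * m \<le> 2 * a\<^sup>2 * (real k * h)" by (intro mult_left_mono) auto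
    \<comment> \<open>Since \<open>l' - 2 * l = 2 * a\<^sup>2\<close>, the square is the stopped
      martingale for \<open>2 * a\<close> times \<open>exp (2 * a\<^sup>2 * m)\<close>, and
      \<open>m\<close> is at most \<open>real k * h\<close>.\<close>
    then have "2 * (a * X \<omega> m - l * m) \<le> 2 * a\<^sup>2 * (real k * h) + (2 * a * X \<omega> m - l' * m)"
      unfolding l l'_def by (simp add: algebra_simps power2_eq_square)
    then show ?thesis
      unfolding stopped_def m_def[symmetric] exp_add[symmetric] exp_double[symmetric] by simp
  qed
  have V: "integrable M (\<lambda>\<omega>. ?C * ?V \<omega>)" "(\<integral>\<omega>. ?C * ?V \<omega> \<partial>M) = ?C"
    using stopped_expectation[OF h l'_def, of x k] by (auto simp: has_bochner_integral_iff)
  note [measurable] = stopped_measurable[OF h]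
  show int: "integrable M (\<lambda>\<omega>. (stopped a l x h k \<omega>)\<^sup>2)"
    by (rule Bochner_Integration.integrable_bound[OF V(1)])
      (auto intro!: AE_I2 order.trans[OF le])
  show "(\<integral>\<omega>. (stopped a l x h k \<omega>)\<^sup>2 \<partial>M) \<le> ?C"
    using integral_mono[OF int V(1) le] V(2) by simp
qed

section \<open>Optional stopping in continuous time\<close>

lemma stopped_tendsto:
  assumes "0 < T" "\<omega> \<in> space M"
  shows "(\<lambda>n. stopped a l x (T / real (Suc n)) (Suc n) \<omega>)
    \<longlonglongrightarrow> exp (a * X \<omega> (entry_time (X \<omega>) x T) - l * entry_time (X \<omega>) x T)"
proof -
  note lim = grid_index_tendsto[OF X_cont[OF assms(2)] assms(1), of x]
  have "(\<lambda>n. X \<omega> (real (grid_index (X \<omega>) x (T / real (Suc n)) (Suc n)) * (T / real (Suc n))))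
     \<longlonglongrightarrow> X \<omega> (entry_time (X \<omega>) x T)"
    by (rule continuous_on_tendsto_compose[OF X_cont[OF assms(2)] lim])
      (use assms(1) entry_time_nonneg[of T] in \<open>auto intro!: always_eventually\<close>)
  with lim show ?thesis unfolding stopped_def by (intro tendsto_intros)
qed

lemma entry_martingale_measurable:
  assumes "0 < T"
  shows "(\<lambda>\<omega>. exp (a * X \<omega> (entry_time (X \<omega>) x T) - l * entry_time (X \<omega>) x T)) \<in> borel_measurable M"
  by (rule borel_measurable_LIMSEQ_real[OF stopped_tendsto[OF assms]])
    (use assms in \<open>auto intro!: stopped_measurable\<close>)

text \<open>On the grid the expectation is \<open>1\<close>, but the sampled path may overshoot
  \<open>x\<close>, so dominated convergence is applied to the truncations at \<open>R\<close>. The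
  limit is bounded by \<open>exp (a * x)\<close> and unaffected by truncation at
  \<open>R \<ge> exp (a * x)\<close>; the second moment bound limits the mass lost on the grid to
  \<open>C / R\<close>, and \<open>R\<close> tends to infinity.\<close>

lemma entry_expectation:
  assumes T: "0 < T" and a: "0 \<le> a" and x: "0 < x" and l: "l = a\<^sup>2 - \<mu> * a" "0 \<le> l"
  shows "(\<integral>\<omega>. exp (a * X \<omega> (entry_time (X \<omega>) x T) - l * entry_time (X \<omega>) x T) \<partial>M) = 1"
proof -
  let ?N = "\<lambda>\<omega>. exp (a * X \<omega> (entry_time (X \<omega>) x T) - l * entry_time (X \<omega>) x T)"
  let ?W = "\<lambda>n. stopped a l x (T / real (Suc n)) (Suc n)"
  define C where "C = exp (2 * a\<^sup>2 * T)"
  have h: "0 < T / real (Suc n)" for n using T by auto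
  note [measurable] = entry_martingale_measurable[OF T] stopped_measurable[OF h]
  have W: "integrable M (?W n)" "(\<integral>\<omega>. ?W n \<omega> \<partial>M) = 1" for n
    using stopped_expectation[OF h[of n] l(1), of x "Suc n"] by (auto simp only: has_bochner_integral_iff)
  have W2: "integrable M (\<lambda>\<omega>. (?W n \<omega>)\<^sup>2)" "(\<integral>\<omega>. (?W n \<omega>)\<^sup>2 \<partial>M) \<le> C" for n
    using stopped_square[OF h[of n] l(1), of x "Suc n"] T unfolding C_def by auto
  have Wpos: "0 < ?W n \<omega>" for n \<omega> by (simp add: stopped_def)
  have bound: "?N \<omega> \<le> exp (a * x)" if \<omega>: "\<omega> \<in> space M" for \<omega>
  proof -
    have "a * X \<omega> (entry_time (X \<omega>) x T) \<le> a * x"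
      using entry_time_value_le[OF X_cont[OF \<omega>], of x T] X_0[OF \<omega>] x T a
      by (intro mult_left_mono) auto
    moreover have "0 \<le> l * entry_time (X \<omega>) x T"
      using l T entry_time_nonneg[of T] by (intro mult_nonneg_nonneg) auto
    ultimately show ?thesis by simp
  qed
  have key: "1 - C / R \<le> integral\<^sup>L M ?N \<and> integral\<^sup>L M ?N \<le> 1" if R: "exp (a * x) \<le> R" for R
  proof -
    have R0: "0 < R" using R by (rule less_le_trans[rotated]) simp
    have min_le: "norm (min (?W n \<omega>) R) \<le> R" for n \<omega>
      using Wpos[of n \<omega>] R0 unfolding real_norm_def by linarith
    have mI: "integrable M (\<lambda>\<omega>. min (?W n \<omega>) R)" for n
      by (intro integrable_const_bound[where B=R] AE_I2 min_le) measurable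
    have lim: "(\<lambda>n. \<integral>\<omega>. min (?W n \<omega>) R \<partial>M) \<longlonglongrightarrow> (\<integral>\<omega>. min (?N \<omega>) R \<partial>M)"
    proof (rule integral_dominated_convergence[where w="\<lambda>_. R"])
      show "AE \<omega> in M. (\<lambda>n. min (?W n \<omega>) R) \<longlonglongrightarrow> min (?N \<omega>) R"
        using stopped_tendsto[OF T] by (auto intro!: AE_I2 tendsto_min)
      show "AE \<omega> in M. norm (min (?W n \<omega>) R) \<le> R" for n
        by (intro AE_I2 min_le)
    qed (simp_all del: of_nat_Suc)
    have "(\<integral>\<omega>. min (?N \<omega>) R \<partial>M) = integral\<^sup>L M ?N"
      by (intro Bochner_Integration.integral_cong refl min_absorb1 order.trans[OF bound R])
    with lim have lim: "(\<lambda>n. \<integral>\<omega>. min (?W n \<omega>) R \<partial>M) \<longlonglongrightarrow> integral\<^sup>L M ?N" by simp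
    have up: "(\<integral>\<omega>. min (?W n \<omega>) R \<partial>M) \<le> 1" for n
      using integral_mono[OF mI W(1), of n n] W(2)[of n] by simp
    have lo: "1 - C / R \<le> (\<integral>\<omega>. min (?W n \<omega>) R \<partial>M)" for n
    proof -
      \<comment> \<open>Below \<open>R\<close> a nonnegative term is subtracted from
        \<open>?W n \<omega>\<close>; above \<open>R\<close> the left side is at most
        \<open>0\<close>.\<close>
      have "?W n \<omega> - (?W n \<omega>)\<^sup>2 / R \<le> min (?W n \<omega>) R" for \<omega>
      proof (cases "?W n \<omega> \<le> R")
        case False
        then have "?W n \<omega> * R \<le> (?W n \<omega>)\<^sup>2"
          using Wpos[of n \<omega>] by (auto simp: power2_eq_square)
        then have "?W n \<omega> \<le> (?W n \<omega>)\<^sup>2 / R" using R0 by (simp add: field_simps)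
        then show ?thesis using False R0 by auto
      qed (use R0 in auto)
      then have "(\<integral>\<omega>. ?W n \<omega> - (?W n \<omega>)\<^sup>2 / R \<partial>M) \<le> (\<integral>\<omega>. min (?W n \<omega>) R \<partial>M)"
        using W(1) W2(1) mI by (intro integral_mono) auto
      moreover have "(\<integral>\<omega>. ?W n \<omega> - (?W n \<omega>)\<^sup>2 / R \<partial>M) = 1 - (\<integral>\<omega>. (?W n \<omega>)\<^sup>2 \<partial>M) / R"
        using W W2(1) by simp
      moreover have "(\<integral>\<omega>. (?W n \<omega>)\<^sup>2 \<partial>M) / R \<le> C / R"
        using W2(2) R0 by (intro divide_right_mono) auto
      ultimately show ?thesis by simp
    qed
    show ?thesis using LIMSEQ_le_const[OF lim] LIMSEQ_le_const2[OF lim] up lo by blast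
  qed
  have "((\<lambda>R. 1 - C / R) \<longlongrightarrow> 1 - 0) at_top"
    by (intro tendsto_intros tendsto_divide_0[OF tendsto_const] filterlim_at_top_imp_at_infinity filterlim_ident)
  then have "((\<lambda>R. 1 - C / R) \<longlongrightarrow> 1) at_top" by simp
  moreover have "eventually (\<lambda>R. 1 - C / R \<le> integral\<^sup>L M ?N) at_top"
    using eventually_ge_at_top[of "exp (a * x)"] by eventually_elim (use key in blast)
  ultimately have "1 \<le> integral\<^sup>L M ?N"
    by (intro tendsto_le[OF _ tendsto_const]) auto
  then show ?thesis using key[of "exp (a * x)"] by auto
qed

text \<open>The choice \<open>a = 0\<close>, \<open>l = 1\<close> reduces the stopped exponential to
  \<open>exp (- entry_time ...)\<close>. The horizons \<open>Suc n\<close> are positive, as the grid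
  approximation requires.\<close>

lemma entry_discount_measurable:
  "(\<lambda>\<omega>. entry_discount (X \<omega>) x) \<in> borel_measurable M"
proof (rule borel_measurable_LIMSEQ_real)
  show "(\<lambda>n. exp (- entry_time (X \<omega>) x (real (Suc n)))) \<longlonglongrightarrow> entry_discount (X \<omega>) x" for \<omega>
    using exp_neg_entry_time_tendsto[of "X \<omega>" x] by (rule LIMSEQ_Suc)
  show "(\<lambda>\<omega>. exp (- entry_time (X \<omega>) x (real (Suc n)))) \<in> borel_measurable M" for n
    using entry_martingale_measurable[of "real (Suc n)" 0 x 1] by simp
qed

text \<open>The horizon in \<open>entry_expectation\<close> tends to infinity, with the constant
  \<open>exp (a * x)\<close> as dominating function.\<close>

lemma entry_discount_moment:
  assumes x: "0 < x" and n: "0 < n" and a: "0 \<le> a" "a\<^sup>2 - \<mu> * a = real n"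
  shows "(\<integral>\<omega>. entry_discount (X \<omega>) x ^ n \<partial>M) = exp (- a * x)"
proof -
  let ?N = "\<lambda>k \<omega>. exp (a * X \<omega> (entry_time (X \<omega>) x (real (Suc k))) -
      real n * entry_time (X \<omega>) x (real (Suc k)))"
  note [measurable] = entry_discount_measurable
  have "(\<lambda>k. integral\<^sup>L M (?N k)) \<longlonglongrightarrow> (\<integral>\<omega>. exp (a * x) * entry_discount (X \<omega>) x ^ n \<partial>M)"
  proof (rule integral_dominated_convergence[where w="\<lambda>_. exp (a * x)"])
    show "?N k \<in> borel_measurable M" for k by (rule entry_martingale_measurable) auto
    show "AE \<omega> in M. (\<lambda>k. ?N k \<omega>) \<longlonglongrightarrow> exp (a * x) * entry_discount (X \<omega>) x ^ n"
    proof (rule AE_I2)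
      fix \<omega> assume \<omega>: "\<omega> \<in> space M"
      show "(\<lambda>k. ?N k \<omega>) \<longlonglongrightarrow> exp (a * x) * entry_discount (X \<omega>) x ^ n"
        using LIMSEQ_Suc[OF exp_entry_time_tendsto[OF X_cont[OF \<omega>] _ x a(1) n]] X_0[OF \<omega>] x by simp
    qed
    show "AE \<omega> in M. norm (?N k \<omega>) \<le> exp (a * x)" for k
    proof (rule AE_I2)
      fix \<omega> assume \<omega>: "\<omega> \<in> space M"
      have "a * X \<omega> (entry_time (X \<omega>) x (real (Suc k))) \<le> a * x"
        using entry_time_value_le[OF X_cont[OF \<omega>], of x "real (Suc k)"] X_0[OF \<omega>] x a
        by (intro mult_left_mono) auto
      moreover have "0 \<le> real n * entry_time (X \<omega>) x (real (Suc k))"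
        using entry_time_nonneg[of "real (Suc k)"] by (intro mult_nonneg_nonneg) auto
      ultimately show "norm (?N k \<omega>) \<le> exp (a * x)" by simp
    qed
  qed auto
  moreover have "integral\<^sup>L M (?N k) = 1" for k
    using a x by (intro entry_expectation) auto
  ultimately have "(\<lambda>k. 1) \<longlonglongrightarrow> exp (a * x) * (\<integral>\<omega>. entry_discount (X \<omega>) x ^ n \<partial>M)" by simp
  then have "exp (a * x) * (\<integral>\<omega>. entry_discount (X \<omega>) x ^ n \<partial>M) = 1"
    by (simp add: LIMSEQ_const_iff)
  then show ?thesis by (simp add: exp_minus field_simps)
qed

section \<open>The running maximum\<close>

lemma prob_X_eq:
  assumes t: "0 < t"
  shows "measure M {\<omega>\<in>space M. X \<omega> t = x} = 0"
proof -
  \<comment> \<open>\<open>c\<close> is the value of \<open>B t\<close> at which \<open>X\<close>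
    equals \<open>x\<close>. The density is available for increments, hence the detour through
    \<open>B t \<omega> - B 0 \<omega>\<close>.\<close>
  define c where "c = (x + \<mu> * t) / sqrt 2"
  have D: "distributed M lborel (\<lambda>\<omega>. B t \<omega> - B 0 \<omega>)
      (\<lambda>x. ennreal (normal_density 0 (sqrt (t - 0)) x))"
    using BM t unfolding standard_BM_def by blast
  have "{\<omega>\<in>space M. X \<omega> t = x} = (\<lambda>\<omega>. B t \<omega> - B 0 \<omega>) -` {c} \<inter> space M"
    using BM by (auto simp: X_def c_def standard_BM_def field_simps)
  also have "emeasure M \<dots> = (\<integral>\<^sup>+y. ennreal (normal_density 0 (sqrt (t - 0)) y) * indicator {c} y \<partial>lborel)"
    by (rule distributed_emeasure[OF D]) auto
  also have "\<dots> = 0"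
    by (rule nn_integral_null_set) (auto simp: null_sets_def)
  finally show ?thesis by (simp add: measure_def)
qed

text \<open>The two right sides differ only by entry at exactly \<open>t\<close>, which forces
  \<open>X \<omega> t = x\<close>, a null event. Both forms serve because the event that the inverse
  subordinator at \<open>t\<close> exceeds \<open>x\<close> lies between \<open>H x < t\<close> and
  \<open>H x \<le> t\<close>, up to a null set.\<close>

lemma prob_Sup_gt:
  assumes t: "0 < t" and x: "0 < x"
  shows "measure M {\<omega>\<in>space M. x < Sup (X \<omega> ` {0..t})} =
         measure M {\<omega>\<in>space M. exp (- t) \<le> entry_discount (X \<omega>) x}"
    and "measure M {\<omega>\<in>space M. x < Sup (X \<omega> ` {0..t})} =
         measure M {\<omega>\<in>space M. exp (- t) < entry_discount (X \<omega>) x}"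
proof -
  note [measurable] = entry_discount_measurable
  have iff: "x < Sup (X \<omega> ` {0..t}) \<longleftrightarrow> exp (- t) < entry_discount (X \<omega>) x" if "\<omega> \<in> space M" for \<omega>
    using less_Sup_image_iff[OF X_cont[OF that]] entry_discount_gt_iff[OF X_cont[OF that] t] t by simp
  then show 2: "measure M {\<omega>\<in>space M. x < Sup (X \<omega> ` {0..t})} =
         measure M {\<omega>\<in>space M. exp (- t) < entry_discount (X \<omega>) x}"
    by (intro arg_cong[where f="measure M"]) auto
  have [measurable]: "(\<lambda>\<omega>. X \<omega> t) \<in> borel_measurable M" using t by (intro X_measurable) auto
  have eqD: "X \<omega> t = x" if "\<omega> \<in> space M" "entry_discount (X \<omega>) x = exp (- t)" for \<omega>
    using entry_discount_eqD[OF X_cont[OF that(1)] _ that(2)] X_0[OF that(1)] x by simp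
  have "measure M {\<omega>\<in>space M. exp (- t) \<le> entry_discount (X \<omega>) x} \<le>
      measure M ({\<omega>\<in>space M. exp (- t) < entry_discount (X \<omega>) x} \<union> {\<omega>\<in>space M. X \<omega> t = x})"
    by (rule finite_measure_mono) (use eqD in \<open>force simp: le_less\<close>, measurable)
  also have "\<dots> \<le> measure M {\<omega>\<in>space M. exp (- t) < entry_discount (X \<omega>) x} +
      measure M {\<omega>\<in>space M. X \<omega> t = x}"
    by (rule measure_Un_le) measurable
  finally have "measure M {\<omega>\<in>space M. exp (- t) \<le> entry_discount (X \<omega>) x} \<le>
      measure M {\<omega>\<in>space M. exp (- t) < entry_discount (X \<omega>) x}"
    using prob_X_eq[OF t] by simp
  moreover have "measure M {\<omega>\<in>space M. exp (- t) < entry_discount (X \<omega>) x} \<le>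
      measure M {\<omega>\<in>space M. exp (- t) \<le> entry_discount (X \<omega>) x}"
    by (rule finite_measure_mono) (auto, measurable)
  ultimately show "measure M {\<omega>\<in>space M. x < Sup (X \<omega> ` {0..t})} =
         measure M {\<omega>\<in>space M. exp (- t) \<le> entry_discount (X \<omega>) x}"
    using 2 by simp
qed

text \<open>At a positive level the superlevel set of the maximum is one of
  \<open>entry_discount\<close>. Level \<open>0\<close> is a countable union of these, and a
  negative level gives the whole space because the path starts at \<open>0\<close>.\<close>

lemma Sup_measurable:
  assumes t: "0 < t"
  shows "(\<lambda>\<omega>. Sup (X \<omega> ` {0..t})) \<in> borel_measurable M"
proof (rule borel_measurableI_greater)
  fix x :: real
  have pos: "{\<omega>\<in>space M. y < Sup (X \<omega> ` {0..t})} \<in> sets M" if y: "0 < y" for y :: real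
  proof -
    note [measurable] = entry_discount_measurable
    have "{\<omega>\<in>space M. y < Sup (X \<omega> ` {0..t})} = {\<omega>\<in>space M. exp (- t) < entry_discount (X \<omega>) y}"
      using less_Sup_image_iff[OF X_cont] entry_discount_gt_iff[OF X_cont t] t by auto
    then show ?thesis by simp
  qed
  consider "0 < x" | "x = 0" | "x < 0" by linarith
  then show "{\<omega>\<in>space M. x < Sup (X \<omega> ` {0..t})} \<in> sets M"
  proof cases
    case 1
    then show ?thesis by (rule pos)
  next
    case 2
    have "{\<omega>\<in>space M. x < Sup (X \<omega> ` {0..t})} =
        (\<Union>n. {\<omega>\<in>space M. inverse (real (Suc n)) < Sup (X \<omega> ` {0..t})})"
      using 2 by (auto dest!: reals_Archimedean intro: less_trans[rotated])
    also have "\<dots> \<in> sets M" by (intro sets.countable_UN) (auto intro!: pos)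
    finally show ?thesis .
  next
    case 3
    have "x < Sup (X \<omega> ` {0..t})" if "\<omega> \<in> space M" for \<omega>
      using less_Sup_image_iff[OF X_cont[OF that], of t x] X_0[OF that] t 3 by force
    then have "{\<omega>\<in>space M. x < Sup (X \<omega> ` {0..t})} = space M" by auto
    then show ?thesis by simp
  qed
qed

lemma Sup_nonneg: "\<omega> \<in> space M \<Longrightarrow> 0 < t \<Longrightarrow> 0 \<le> Sup (X \<omega> ` {0..t})"
  using less_Sup_image_iff[OF X_cont, of \<omega> t] X_0[of \<omega>]
  by (metis atLeastAtMost_iff less_eq_real_def not_less order_refl)

end

section \<open>Subordinators and their inverses\<close>

lemma
  assumes "subordinator N H"
  shows subordinator_prob_space: "prob_space N"
    and subordinator_measurable: "0 \<le> s \<Longrightarrow> H s \<in> borel_measurable N"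
    and subordinator_mono: "\<omega> \<in> space N \<Longrightarrow> 0 \<le> s \<Longrightarrow> s \<le> u \<Longrightarrow> H s \<omega> \<le> H u \<omega>"
    and subordinator_nonneg: "\<omega> \<in> space N \<Longrightarrow> 0 \<le> s \<Longrightarrow> 0 \<le> H s \<omega>"
    and subordinator_right_cont: "\<omega> \<in> space N \<Longrightarrow> 0 \<le> s \<Longrightarrow> continuous (at_right s) (\<lambda>s. H s \<omega>)"
proof -
  show "prob_space N" "0 \<le> s \<Longrightarrow> H s \<in> borel_measurable N"
    "\<omega> \<in> space N \<Longrightarrow> 0 \<le> s \<Longrightarrow> continuous (at_right s) (\<lambda>s. H s \<omega>)"
    using assms by (auto simp: subordinator_def)
  have mono: "H s \<omega> \<le> H u \<omega>" if "\<omega> \<in> space N" "0 \<le> s" "s \<le> u" for s u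
    using assms that unfolding subordinator_def mono_on_def by fastforce
  then show "\<omega> \<in> space N \<Longrightarrow> 0 \<le> s \<Longrightarrow> s \<le> u \<Longrightarrow> H s \<omega> \<le> H u \<omega>" by blast
  show "0 \<le> H s \<omega>" if "\<omega> \<in> space N" "0 \<le> s"
    using mono[of 0 s] that assms by (auto simp: subordinator_def)
qed

lemma inverse_subordinator_gtD:
  assumes "0 < t" "0 < x" "x < inverse_subordinator H t \<omega>"
  shows "H x \<omega> \<le> t"
proof (rule ccontr)
  assume "\<not> H x \<omega> \<le> t"
  then have "Inf {s. 0 < s \<and> t < H s \<omega>} \<le> x"
    using assms by (intro cInf_lower bdd_belowI[of _ 0]) auto
  then show False using assms by (simp add: inverse_subordinator_def)
qed

text \<open>Right continuity keeps \<open>H\<close> below \<open>t\<close> until some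
  \<open>s > x\<close>, and by monotonicity no time before \<open>s\<close> belongs to the set; this
  makes the inequality strict. The assumption \<open>ex\<close> excludes the infimum of the empty
  set, whose value is unspecified.\<close>

lemma inverse_subordinator_gtI:
  assumes H: "subordinator N H" and \<omega>: "\<omega> \<in> space N" and x: "0 \<le> x" and t: "0 < t" "H x \<omega> < t"
    and ex: "\<exists>s>0. t < H s \<omega>"
  shows "x < inverse_subordinator H t \<omega>"
proof -
  have "((\<lambda>s. H s \<omega>) \<longlongrightarrow> H x \<omega>) (at_right x)"
    using subordinator_right_cont[OF H \<omega> x] by (simp add: continuous_within)
  then have "eventually (\<lambda>s. H s \<omega> < t) (at_right x)"
    using t(2) by (rule order_tendstoD)
  then obtain b where b: "b > x" "\<And>s. x < s \<Longrightarrow> s < b \<Longrightarrow> H s \<omega> < t"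
    by (auto simp: eventually_at_right_field)
  define s where "s = (x + b) / 2"
  have s: "x < s" "H s \<omega> < t" using b by (auto simp: s_def)
  have "s \<le> u" if "0 < u" "t < H u \<omega>" for u
    using subordinator_mono[OF H \<omega>, of u s] that s by (cases "s \<le> u") auto
  then have "s \<le> Inf {s. 0 < s \<and> t < H s \<omega>}" using ex by (intro cInf_greatest) auto
  then show ?thesis using s t by (simp add: inverse_subordinator_def)
qed

lemma inverse_subordinator_nonneg:
  assumes "\<exists>s>0. t < H s \<omega>"
  shows "0 \<le> inverse_subordinator H t \<omega>"
  using assms unfolding inverse_subordinator_def by (auto intro!: cInf_greatest)

lemma has_laplace_exponentD:
  "has_laplace_exponent N H \<Phi> \<Longrightarrow> 0 \<le> l \<Longrightarrow> 0 \<le> t \<Longrightarrow> (\<integral>\<omega>. exp (- l * H t \<omega>) \<partial>N) = exp (- t * \<Phi> l)"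
  by (simp add: has_laplace_exponent_def)

text \<open>A Markov bound with exponent \<open>1\<close>: where \<open>H\<close> stays at or below
  \<open>t\<close>, \<open>exp (- H n)\<close> is at least \<open>exp (- t)\<close>, while its mean
  \<open>exp (- n * \<Phi> 1)\<close> tends to \<open>0\<close>.\<close>

lemma subordinator_AE_exceeds:
  assumes H: "subordinator N H" and \<Phi>: "has_laplace_exponent N H \<Phi>" "0 < \<Phi> 1"
  shows "AE \<omega> in N. \<exists>s>0. t < H s \<omega>"
proof -
  interpret prob_space N by (rule subordinator_prob_space[OF H])
  have [measurable]: "H (real n) \<in> borel_measurable N" for n
    by (rule subordinator_measurable[OF H]) auto
  define E where "E = {\<omega>\<in>space N. \<forall>n. H (real (Suc n)) \<omega> \<le> t}"
  have [measurable]: "E \<in> sets N" unfolding E_def by measurable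
  have bound: "measure N E \<le> exp t * exp (- real (Suc n) * \<Phi> 1)" for n
  proof -
    have "exp (- t) * measure N E = (\<integral>\<omega>. exp (- t) * indicator E \<omega> \<partial>N)" by simp
    also have "\<dots> \<le> (\<integral>\<omega>. exp (- 1 * H (real (Suc n)) \<omega>) \<partial>N)"
    proof (rule integral_mono)
      show "integrable N (\<lambda>\<omega>. exp (- 1 * H (real (Suc n)) \<omega>))"
        using subordinator_nonneg[OF H]
        by (intro integrable_const_bound[where B=1]) (auto intro!: AE_I2 simp del: of_nat_Suc)
      show "exp (- t) * indicator E \<omega> \<le> exp (- 1 * H (real (Suc n)) \<omega>)" for \<omega>
        unfolding E_def by (auto simp: indicator_def)
      show "integrable N (\<lambda>\<omega>. exp (- t) * indicator E \<omega>)"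
        by (intro integrable_mult_right integrable_const_bound[where B=1]) (auto simp: indicator_def)
    qed
    also have "\<dots> = exp (- real (Suc n) * \<Phi> 1)"
      by (rule has_laplace_exponentD[OF \<Phi>(1)]) auto
    finally have "exp t * (exp (- t) * measure N E) \<le> exp t * exp (- real (Suc n) * \<Phi> 1)"
      by (rule mult_left_mono) auto
    moreover have "exp t * (exp (- t) * measure N E) = measure N E" by (simp add: exp_minus)
    ultimately show ?thesis by (simp only:)
  qed
  have "(\<lambda>n. exp t * exp (- real (Suc n) * \<Phi> 1)) \<longlonglongrightarrow> exp t * 0"
  proof (intro tendsto_mult_left filterlim_compose[OF exp_at_bot])
    have "filterlim (\<lambda>n. real (Suc n) * \<Phi> 1) at_top sequentially"
      by (intro filterlim_at_top_mult_tendsto_pos[OF tendsto_const] \<Phi>(2)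
          filterlim_compose[OF filterlim_real_sequentially filterlim_Suc])
    then show "filterlim (\<lambda>n. - real (Suc n) * \<Phi> 1) at_bot sequentially"
      by (simp add: filterlim_uminus_at_bot del: of_nat_Suc)
  qed
  then have "measure N E \<le> exp t * 0"
    by (rule LIMSEQ_le_const) (intro exI allI impI bound)
  then have "measure N E = 0" using measure_nonneg[of N E] by linarith
  then have "E \<in> null_sets N" by (auto simp: emeasure_eq_measure)
  then show ?thesis
  proof (rule AE_I')
    show "{\<omega>\<in>space N. \<not> (\<exists>s>0. t < H s \<omega>)} \<subseteq> E"
      unfolding E_def using of_nat_0_less_iff zero_less_Suc by (blast intro: leI)
  qed
qed

section \<open>Comparison of the maximum with the inverse subordinator\<close>

context brownian_drift
begin

text \<open>The value \<open>a = r + \<mu> / 2\<close> is the nonnegative root of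
  \<open>a\<^sup>2 - \<mu> * a = real n\<close>. Writing it as
  \<open>\<mu> + (r - \<mu> / 2)\<close> splits off the killing factor and leaves the Laplace
  exponent of \<open>H\<close> at \<open>n\<close>.\<close>

lemma entry_discount_moment_eq:
  assumes \<mu>: "0 < \<mu>" and x: "0 < x" and n: "0 < n" and H: "subordinator N H"
    and \<Phi>: "has_laplace_exponent N H (\<lambda>l. sqrt (l + (\<mu> / 2)\<^sup>2) - sqrt ((\<mu> / 2)\<^sup>2))"
  shows "(\<integral>\<omega>. entry_discount (X \<omega>) x ^ n \<partial>M) = exp (- \<mu> * x) * (\<integral>\<omega>. exp (- H x \<omega>) ^ n \<partial>N)"
proof -
  define r where "r = sqrt (real n + (\<mu> / 2)\<^sup>2)"
  have r: "0 \<le> r" "r\<^sup>2 = real n + (\<mu> / 2)\<^sup>2" by (auto simp: r_def)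
  have "(\<integral>\<omega>. entry_discount (X \<omega>) x ^ n \<partial>M) = exp (- (r + \<mu> / 2) * x)"
    using \<mu> r by (intro entry_discount_moment x n) (auto simp: power2_eq_square algebra_simps)
  also have "\<dots> = exp (- \<mu> * x) * exp (- x * (r - \<mu> / 2))"
    unfolding exp_add[symmetric] by (simp add: algebra_simps)
  also have "exp (- x * (r - \<mu> / 2)) = (\<integral>\<omega>. exp (- real n * H x \<omega>) \<partial>N)"
    using has_laplace_exponentD[OF \<Phi>, of "real n" x] x \<mu> by (simp add: r_def)
  also have "\<dots> = (\<integral>\<omega>. exp (- H x \<omega>) ^ n \<partial>N)"
    by (simp add: exp_of_nat_mult[symmetric])
  finally show ?thesis .
qed

text \<open>A sandwich: up to a null set, \<open>H x < t\<close> implies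
  \<open>x < inverse_subordinator H t\<close>, which implies \<open>H x \<le> t\<close>. After
  scaling by \<open>exp (- \<mu> * x)\<close> the outer probabilities become those of entry before
  \<open>t\<close> and entry by \<open>t\<close>, which coincide.\<close>

lemma prob_inverse_subordinator_gt:
  assumes \<mu>: "0 < \<mu>" and x: "0 < x" and t: "0 < t" and H: "subordinator N H"
    and \<Phi>: "has_laplace_exponent N H (\<lambda>l. sqrt (l + (\<mu> / 2)\<^sup>2) - sqrt ((\<mu> / 2)\<^sup>2))"
    and [measurable]: "inverse_subordinator H t \<in> borel_measurable N"
  shows "measure M {\<omega>\<in>space M. x < Sup (X \<omega> ` {0..t})} =
    exp (- \<mu> * x) * measure N {\<omega>\<in>space N. x < inverse_subordinator H t \<omega>}"
proof (rule antisym)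
  interpret N: prob_space N by (rule subordinator_prob_space[OF H])
  have [measurable]: "H x \<in> borel_measurable N"
    using subordinator_measurable[OF H] x by simp
  note meas = entry_discount_measurable
  have Z: "exp (- H x \<omega>) \<in> {0..1}" if "\<omega> \<in> space N" for \<omega>
    using subordinator_nonneg[OF H that] x by simp
  note mom = entry_discount_moment_eq[OF \<mu> x _ H \<Phi>]
  have le: "measure M {\<omega>\<in>space M. exp (- t) \<le> entry_discount (X \<omega>) x} =
      exp (- \<mu> * x) * measure N {\<omega>\<in>space N. exp (- t) \<le> exp (- H x \<omega>)}"
    by (rule prob_ge_eq_of_moments[OF prob_space_axioms N.prob_space_axioms meas _ _ Z mom])
      (use entry_discount_bounds in auto)
  have lt: "measure M {\<omega>\<in>space M. exp (- t) < entry_discount (X \<omega>) x} =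
      exp (- \<mu> * x) * measure N {\<omega>\<in>space N. exp (- t) < exp (- H x \<omega>)}"
    by (rule prob_gt_eq_of_moments[OF prob_space_axioms N.prob_space_axioms meas _ _ Z mom])
      (use entry_discount_bounds in auto)
  have "measure N {\<omega>\<in>space N. x < inverse_subordinator H t \<omega>} \<le>
      measure N {\<omega>\<in>space N. exp (- t) \<le> exp (- H x \<omega>)}"
    using inverse_subordinator_gtD[OF t x]
    by (intro N.finite_measure_mono) auto
  then show "exp (- \<mu> * x) * measure N {\<omega>\<in>space N. x < inverse_subordinator H t \<omega>} \<le>
      measure M {\<omega>\<in>space M. x < Sup (X \<omega> ` {0..t})}"
    unfolding prob_Sup_gt(1)[OF t x] le by (intro mult_left_mono) auto
  have pos: "0 < sqrt (1 + (\<mu> / 2)\<^sup>2) - sqrt ((\<mu> / 2)\<^sup>2)"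
    unfolding diff_gt_0_iff_gt by (rule real_sqrt_less_mono) simp
  have "measure N {\<omega>\<in>space N. exp (- t) < exp (- H x \<omega>)} \<le>
      measure N {\<omega>\<in>space N. x < inverse_subordinator H t \<omega>}"
  proof (rule N.finite_measure_mono_AE)
    show "AE \<omega> in N. \<omega> \<in> {\<omega>\<in>space N. exp (- t) < exp (- H x \<omega>)} \<longrightarrow>
        \<omega> \<in> {\<omega>\<in>space N. x < inverse_subordinator H t \<omega>}"
      using subordinator_AE_exceeds[OF H \<Phi> pos, of t]
    proof eventually_elim
      case (elim \<omega>)
      then show ?case using inverse_subordinator_gtI[OF H _ _ t] x by auto
    qed
  qed simp
  then show "measure M {\<omega>\<in>space M. x < Sup (X \<omega> ` {0..t})} \<le>
      exp (- \<mu> * x) * measure N {\<omega>\<in>space N. x < inverse_subordinator H t \<omega>}"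
    unfolding prob_Sup_gt(2)[OF t x] lt by (intro mult_left_mono) auto
qed

end

section \<open>From tail probabilities to equality of laws\<close>

lemma real_distribution_eqI_pos:
  assumes D1: "real_distribution D1" and D2: "real_distribution D2"
    and neg: "\<And>x. x < 0 \<Longrightarrow> cdf D1 x = 0" "\<And>x. x < 0 \<Longrightarrow> cdf D2 x = 0"
    and pos: "\<And>x. 0 < x \<Longrightarrow> cdf D1 x = cdf D2 x"
  shows "D1 = D2"
proof (rule cdf_unique[OF D1 D2], rule ext)
  interpret D1: real_distribution D1 by fact
  interpret D2: real_distribution D2 by fact
  fix x :: real
  \<comment> \<open>Right continuity extends the agreement from positive arguments to
    \<open>0\<close>.\<close>
  have "(cdf D2 \<longlongrightarrow> cdf D2 0) (at_right 0)"
    using D2.cdf_is_right_cont by (simp add: continuous_within)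
  moreover have "(cdf D1 \<longlongrightarrow> cdf D1 0) (at_right 0)"
    using D1.cdf_is_right_cont by (simp add: continuous_within)
  then have "(cdf D2 \<longlongrightarrow> cdf D1 0) (at_right 0)"
    by (rule Lim_transform_eventually) (auto simp: pos eventually_at_filter)
  ultimately have "cdf D1 0 = cdf D2 0"
    by (intro tendsto_unique[of "at_right (0::real)"]) auto
  then show "cdf D1 x = cdf D2 x"
    using neg pos by (cases x "0::real" rule: linorder_cases) auto
qed

lemma (in prob_space) cdf_distr_eq:
  assumes [measurable]: "V \<in> borel_measurable M"
  shows "cdf (distr M borel V) x = 1 - measure M {\<omega>\<in>space M. x < V \<omega>}"
proof -
  have "cdf (distr M borel V) x = measure M {\<omega>\<in>space M. V \<omega> \<le> x}"
    by (simp add: cdf_def measure_distr vimage_def Int_def conj_commute)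
  also have "\<dots> = measure M (space M - {\<omega>\<in>space M. x < V \<omega>})"
    by (rule arg_cong[where f="measure M"]) auto
  also have "\<dots> = 1 - measure M {\<omega>\<in>space M. x < V \<omega>}"
    by (rule prob_compl) simp
  finally show ?thesis .
qed

lemma (in prob_space) indep_rv_prob_Int:
  assumes "indep_rv M S X T Y" "A \<in> sets S" "C \<in> sets T"
  shows "measure M ((X -` A \<inter> space M) \<inter> (Y -` C \<inter> space M)) =
    measure M (X -` A \<inter> space M) * measure M (Y -` C \<inter> space M)"
  using assms unfolding indep_rv_def by (intro indep_setD) (auto intro!: sigma_sets.Basic)

theorem theorem4p3:
  fixes \<mu> :: real
    and M1 :: "'a measure" and B :: "real \<Rightarrow> 'a \<Rightarrow> real"
    and M2 :: "'b measure" and H :: "real \<Rightarrow> 'b \<Rightarrow> real" and T :: "'b \<Rightarrow> real"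
  assumes "\<mu> > 0"
    and "standard_BM M1 B"
    and "subordinator M2 H"
    and "has_laplace_exponent M2 H (\<lambda>l. sqrt (l + (\<mu> / 2)\<^sup>2) - sqrt ((\<mu> / 2)\<^sup>2))"
    and "distributed M2 lborel T (\<lambda>x. ennreal (exponential_density \<mu> x))"
    and "indep_rv M2 borel T (PiM {0..} (\<lambda>_. borel))
           (\<lambda>\<omega>. restrict (\<lambda>t. inverse_subordinator H t \<omega>) {0..})"
  shows "\<forall>t>0. distr M1 borel (\<lambda>\<omega>. Sup ((\<lambda>s. - \<mu> * s + sqrt 2 * B s \<omega>) ` {0..t}))
               = distr M2 borel (\<lambda>\<omega>. min (inverse_subordinator H t \<omega>) (T \<omega>))"
proof (intro allI impI)
  fix t :: real assume t: "0 < t"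
  interpret M1: prob_space M1 using assms(2) by (simp add: standard_BM_def)
  interpret bm: brownian_drift M1 B \<mu> by standard (rule assms(2))
  interpret M2: prob_space M2 by (rule subordinator_prob_space[OF assms(3)])
  let ?S = "\<lambda>\<omega>. Sup (bm.X \<omega> ` {0..t})"
  let ?L = "inverse_subordinator H t"
  let ?V = "\<lambda>\<omega>. min (?L \<omega>) (T \<omega>)"
  let ?R = "\<lambda>\<omega>. restrict (\<lambda>t. inverse_subordinator H t \<omega>) {0..}"
  have T [measurable]: "T \<in> borel_measurable M2"
    using assms(5) by (simp add: distributed_def)
  have "?R \<in> measurable M2 (PiM {0..} (\<lambda>_. borel))"
    using assms(6) by (simp add: indep_rv_def)
  then have "(\<lambda>\<omega>. ?R \<omega> t) \<in> borel_measurable M2"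
    by (rule measurable_compose[OF _ measurable_component_singleton]) (use t in simp)
  then have L [measurable]: "?L \<in> borel_measurable M2" using t by simp
  note S [measurable] = bm.Sup_measurable[OF t]
  have key: "measure M1 {\<omega>\<in>space M1. x < ?S \<omega>} = measure M2 {\<omega>\<in>space M2. x < ?V \<omega>}" if x: "0 < x" for x
  proof -
    \<comment> \<open>Independence is assumed for the whole process, so the event for
      \<open>?L\<close> is expressed as a cylinder set in the coordinate \<open>t\<close>.\<close>
    let ?C = "{p \<in> space (PiM {0..} (\<lambda>_. borel)). x < p t}"
    have C: "?C \<in> sets (PiM {0..} (\<lambda>_. borel :: real measure))"
      using t by (intro borel_measurable_less measurable_component_singleton) auto
    have TA: "T -` {x<..} \<inter> space M2 = {\<omega>\<in>space M2. x < T \<omega>}" by auto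
    have LC: "?R -` ?C \<inter> space M2 = {\<omega>\<in>space M2. x < ?L \<omega>}"
      using t by (auto simp: space_PiM)
    have "{\<omega>\<in>space M2. x < ?V \<omega>} = {\<omega>\<in>space M2. x < T \<omega>} \<inter> {\<omega>\<in>space M2. x < ?L \<omega>}" by auto
    also have "measure M2 \<dots> = measure M2 {\<omega>\<in>space M2. x < T \<omega>} * measure M2 {\<omega>\<in>space M2. x < ?L \<omega>}"
      using M2.indep_rv_prob_Int[OF assms(6) _ C, of "{x<..}"] unfolding TA LC by simp
    also have "measure M2 {\<omega>\<in>space M2. x < T \<omega>} = exp (- \<mu> * x)"
      using M2.exponential_distributedD_gt[OF assms(5) _ assms(1), of x] x by (simp add: mult.commute)
    finally show ?thesis
      using bm.prob_inverse_subordinator_gt[OF assms(1) x t assms(3,4) L] by simp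
  qed
  have "distr M1 borel ?S = distr M2 borel ?V"
  proof (rule real_distribution_eqI_pos)
    show "real_distribution (distr M1 borel ?S)" by (rule M1.real_distribution_distr) simp
    show "real_distribution (distr M2 borel ?V)" by (rule M2.real_distribution_distr) simp
    show "cdf (distr M1 borel ?S) x = cdf (distr M2 borel ?V) x" if "0 < x" for x
      using key[OF that] by (simp add: M1.cdf_distr_eq M2.cdf_distr_eq)
    \<comment> \<open>Both variables are nonnegative, the minimum only almost surely:
      \<open>T\<close> is positive outside a null set, and \<open>?L\<close> is nonnegative wherever
      \<open>H\<close> eventually exceeds \<open>t\<close>.\<close>
    fix x :: real assume x: "x < 0"
    have "{\<omega>\<in>space M1. x < ?S \<omega>} = space M1"
      using bm.Sup_nonneg[OF _ t] x by (auto intro: less_le_trans)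
    then show "cdf (distr M1 borel ?S) x = 0" by (simp add: M1.cdf_distr_eq M1.prob_space)
    have "measure M2 {\<omega>\<in>space M2. 0 < T \<omega>} = 1"
      using M2.exponential_distributedD_gt[OF assms(5) _ assms(1), of 0] by simp
    then have "AE \<omega> in M2. 0 < T \<omega>"
      by (subst (asm) M2.prob_Collect_eq_1) auto
    moreover have "AE \<omega> in M2. \<exists>s>0. t < H s \<omega>"
      by (rule subordinator_AE_exceeds[OF assms(3,4)]) (simp add: real_sqrt_less_mono del: real_sqrt_abs)
    ultimately have "AE \<omega> in M2. x < ?V \<omega>"
    proof eventually_elim
      case (elim \<omega>)
      then show ?case using inverse_subordinator_nonneg[of t H \<omega>] x by auto
    qed
    then have "measure M2 {\<omega>\<in>space M2. x < ?V \<omega>} = 1"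
      by (subst M2.prob_Collect_eq_1) auto
    then show "cdf (distr M2 borel ?V) x = 0" by (simp add: M2.cdf_distr_eq)
  qed
  then show "distr M1 borel (\<lambda>\<omega>. Sup ((\<lambda>s. - \<mu> * s + sqrt 2 * B s \<omega>) ` {0..t})) = distr M2 borel ?V"
    by (simp add: bm.X_def[abs_def])
qed

end
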